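(* Let $F:\mathbb{R}^n\to\mathbb{R}^m$ be a centered stationary Gaussian random field as below, with spectral measure $\rho$ and spectral random measure $Z$. If $Z$ is $m$-balls absolute non-degenerate, then $\mathcal{H}_0(\rho)$ is $C^1$-dense in $C^1(B,\mathbb{R}^m)$ for every bounded open set $B\subset\mathbb{R}^n$, i.e. for every $G\in C^1(B,\mathbb{R}^m)$ and $\epsilon>0$ there is $H\in\mathcal{H}_0(\rho)$ with $\|H-G\|_{C^1(B)}<\epsilon$.
   Context: $F=(f_1,\dots,f_m)$ is a centered stationary Gaussian field, a.s. $C^{3-}$, with covariance $k_{i_1i_2}(x-y)=\mathcal{E}(f_{i_1}(x)f_{i_2}(y))$. Its spectral measure $\rho=(\rho_{i_1i_2})$ is the finite positive semi-definite matrix-valued measure on $\mathbb{R}^n$ with $k_{i_1i_2}(x)=\int e^{i\langle x,\xi\rangle}d\rho_{i_1i_2}(\xi)$, and $F(x)=\int e^{i\langle x,\xi\rangle}dZ(\xi)$ for a centered $\mathbb{C}^m$-valued orthogonal random measure $Z$ with $\mathcal{E}(Z_{i_1}(U_1)\overline{Z_{i_2}(U_2)})=\rho_{i_1i_2}(U_1\cap U_2)$. $L^2_H(\rho)$ is the set of $G=(g_1,\dots,g_m):\mathbb{R}^n\to\mathbb{C}^m$ with $\sum_{i_1,i_2}\int g_{i_1}\overline{g_{i_2}}\,d\rho_{i_1i_2}<\infty$ and $G(-x)=\overline{G(x)}$. For $G\in L^2_H(\rho)$, $\mathcal{F}_\rho(G)$ has components $(\mathcal{F}_\rho(G))_{i_2}(x)=\sum_{i_1}\int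 e^{-i\langle x,\xi\rangle}g_{i_1}(\xi)\,d\rho_{i_1i_2}(\xi)$, and $\mathcal{H}_0(\rho)=\mathcal{F}_\rho(L^2_H(\rho))$. $Z$ is $m$-balls absolute non-degenerate if there are open balls $B_{r_1}(y_1),\dots,B_{r_m}(y_m)$ such that for each $t$ and every nonempty open $U\subset B_{r_t}(y_t)$ there are complex constants $c_{t1}(U),\dots,c_{tm}(U)$ with $\sum_ic_{ti}(U)\rho_{is}(U)=\delta_{ts}$ for all $s$ (equivalently $Z_t(U)\notin\mathrm{Span}_{\mathbb{C}}\{Z_s(U):s\neq t\}$), and there are constants $C_1(Z),C_2(Z)>0$ with $|\rho_{st}|(V)\le C_1(Z)|\rho_{st}(V)|$ for all $s,t$ and all open $V\subset\bigcup_iB_{r_i}(y_i)$, and $\sum_i|c_{ti}(U)\rho_{is}(U)|\le C_2(Z)$ for all $s,t$ and open $U\subset B_{r_t}(y_t)$.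
   Formalization: G is assumed to be C^1 on an open neighbourhood of the closure of B, not merely on B: for G(x)=1/x on B=(0,1) the claim fails, since every H in H_0(ρ) is bounded. *)

theory Defs
  imports "HOL-Probability.Probability"
begin

definition centered_gaussian_rv :: "'a measure \<Rightarrow> ('a \<Rightarrow> real) \<Rightarrow> bool" where
  "centered_gaussian_rv M X \<longleftrightarrow> X \<in> borel_measurable M \<and>
     ((AE \<omega> in M. X \<omega> = 0) \<or>
      (\<exists>\<sigma>>0. distributed M lborel X (\<lambda>x. ennreal (normal_density 0 \<sigma> x))))"

definition centered_gaussian_field ::
  "'a measure \<Rightarrow> (real^'n \<Rightarrow> 'a \<Rightarrow> real^'m) \<Rightarrow> bool" where
  "centered_gaussian_field M F \<longleftrightarrow> prob_space M \<and>
     (\<forall>x i. (\<lambda>\<omega>. F x \<omega> $ i) \<in> borel_measurable M) \<and>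
     (\<forall>S c. finite S \<longrightarrow>
        centered_gaussian_rv M (\<lambda>\<omega>. \<Sum>p\<in>S. c p * F (fst p) \<omega> $ snd p))"

definition C3minus :: "(real^'n \<Rightarrow> real^'m) \<Rightarrow> bool" where
  "C3minus f \<longleftrightarrow> (\<exists>f1 f2.
     (\<forall>x. (f has_derivative blinfun_apply (f1 x)) (at x)) \<and>
     (\<forall>x. (f1 has_derivative blinfun_apply (f2 x)) (at x)) \<and>
     (\<forall>x. \<exists>r>0. \<exists>L. \<forall>y\<in>ball x r. \<forall>z\<in>ball x r. norm (f2 y - f2 z) \<le> L * dist y z))"

text \<open>The matrix valued measure rho = (rho_ij) is represented by a finite Borel measure mu on
  R^n together with mu-integrable densities h i j, i.e. rho_ij(U) = integral over U of h i j.\<close>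
definition rho :: "(real^'n) measure \<Rightarrow> ('m \<Rightarrow> 'm \<Rightarrow> real^'n \<Rightarrow> complex) \<Rightarrow>
    'm \<Rightarrow> 'm \<Rightarrow> (real^'n) set \<Rightarrow> complex" where
  "rho mu h i j U = (LINT \<xi>:U|mu. h i j \<xi>)"

text \<open>Total variation |rho_ij|(V) of the complex measure rho_ij.\<close>
definition rho_var :: "(real^'n) measure \<Rightarrow> ('m \<Rightarrow> 'm \<Rightarrow> real^'n \<Rightarrow> complex) \<Rightarrow>
    'm \<Rightarrow> 'm \<Rightarrow> (real^'n) set \<Rightarrow> real" where
  "rho_var mu h i j V = (LINT \<xi>:V|mu. cmod (h i j \<xi>))"

definition psd_matrix_measure ::
  "(real^'n) measure \<Rightarrow> ('m::finite \<Rightarrow> 'm \<Rightarrow> real^'n \<Rightarrow> complex) \<Rightarrow> bool" where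
  "psd_matrix_measure mu h \<longleftrightarrow> sets mu = sets borel \<and> finite_measure mu \<and>
     (\<forall>i j. integrable mu (h i j)) \<and>
     (\<forall>U\<in>sets borel. \<forall>c::'m \<Rightarrow> complex.
        Im (\<Sum>i\<in>UNIV. \<Sum>j\<in>UNIV. c i * cnj (c j) * rho mu h i j U) = 0 \<and>
        Re (\<Sum>i\<in>UNIV. \<Sum>j\<in>UNIV. c i * cnj (c j) * rho mu h i j U) \<ge> 0)"

definition is_spectral_measure ::
  "'a measure \<Rightarrow> (real^'n \<Rightarrow> 'a \<Rightarrow> real^'m) \<Rightarrow> (real^'n) measure \<Rightarrow>
   ('m::finite \<Rightarrow> 'm \<Rightarrow> real^'n \<Rightarrow> complex) \<Rightarrow> bool" where
  "is_spectral_measure M F mu h \<longleftrightarrow> psd_matrix_measure mu h \<and>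
     (\<forall>x y i j. complex_of_real (integral\<^sup>L M (\<lambda>\<omega>. F x \<omega> $ i * F y \<omega> $ j)) =
        (LINT \<xi>|mu. exp (\<i> * complex_of_real ((x - y) \<bullet> \<xi>)) * h i j \<xi>))"

definition L2H :: "(real^'n) measure \<Rightarrow> ('m::finite \<Rightarrow> 'm \<Rightarrow> real^'n \<Rightarrow> complex) \<Rightarrow>
    (real^'n \<Rightarrow> complex^'m) set" where
  "L2H mu h = {G. (\<forall>i. (\<lambda>\<xi>. G \<xi> $ i) \<in> borel_measurable mu) \<and>
     integrable mu (\<lambda>\<xi>. \<Sum>i1\<in>UNIV. \<Sum>i2\<in>UNIV. G \<xi> $ i1 * cnj (G \<xi> $ i2) * h i1 i2 \<xi>) \<and>
     (\<forall>\<xi>. \<forall>i. G (- \<xi>) $ i = cnj (G \<xi> $ i))}"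

definition Frho :: "(real^'n) measure \<Rightarrow> ('m::finite \<Rightarrow> 'm \<Rightarrow> real^'n \<Rightarrow> complex) \<Rightarrow>
    (real^'n \<Rightarrow> complex^'m) \<Rightarrow> (real^'n \<Rightarrow> complex^'m)" where
  "Frho mu h G = (\<lambda>x. \<chi> i2. LINT \<xi>|mu.
      exp (- \<i> * complex_of_real (x \<bullet> \<xi>)) * (\<Sum>i1\<in>UNIV. G \<xi> $ i1 * h i1 i2 \<xi>))"

definition H0 :: "(real^'n) measure \<Rightarrow> ('m::finite \<Rightarrow> 'm \<Rightarrow> real^'n \<Rightarrow> complex) \<Rightarrow>
    (real^'n \<Rightarrow> complex^'m) set" where
  "H0 mu h = Frho mu h ` L2H mu h"

definition m_balls_abs_nondegenerate ::
  "(real^'n) measure \<Rightarrow> ('m::finite \<Rightarrow> 'm \<Rightarrow> real^'n \<Rightarrow> complex) \<Rightarrow> bool" where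
  "m_balls_abs_nondegenerate mu h \<longleftrightarrow>
     (\<exists>(y :: 'm \<Rightarrow> real^'n) (r :: 'm \<Rightarrow> real) (c :: 'm \<Rightarrow> (real^'n) set \<Rightarrow> 'm \<Rightarrow> complex)
        C1 C2.
        (\<forall>t. r t > 0) \<and> C1 > 0 \<and> C2 > 0 \<and>
        (\<forall>t U. open U \<and> U \<noteq> {} \<and> U \<subseteq> ball (y t) (r t) \<longrightarrow>
           (\<forall>s. (\<Sum>i\<in>UNIV. c t U i * rho mu h i s U) = (if t = s then 1 else 0))) \<and>
        (\<forall>s t V. open V \<and> V \<subseteq> (\<Union>i. ball (y i) (r i)) \<longrightarrow>
           rho_var mu h s t V \<le> C1 * cmod (rho mu h s t V)) \<and>
        (\<forall>s t U. open U \<and> U \<subseteq> ball (y t) (r t) \<longrightarrow>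
           (\<Sum>i\<in>UNIV. cmod (c t U i * rho mu h i s U)) \<le> C2))"

definition cvec :: "real^'m \<Rightarrow> complex^'m" where
  "cvec v = (\<chi> j. complex_of_real (v $ j))"

end

theory Submission
  imports Defs "HOL-Real_Asymp.Real_Asymp"
begin

text \<open>Feeding the functions \<open>a c\<^sub>t\<^sub>i(U) 1\<^sub>U\<close>, symmetrized under \<open>\<xi> \<mapsto> - \<xi>\<close>, into \<open>\<F>\<^sub>\<rho>\<close> for small balls \<open>U\<close> around
  \<open>\<xi> \<in> B\<^bsub>r\<^sub>t\<^esub>(y\<^sub>t)\<close> produces functions that converge in \<open>C\<^sup>1\<close> on bounded sets to \<open>Re (a exp (- i x \<bullet> \<xi>))\<close> times the
  \<open>t\<close>-th unit vector; the constants of absolute non-degeneracy control the error. So the closure contains the real parts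
  of all exponential sums with frequencies in an arbitrarily small ball, and these are \<open>C\<^sup>1\<close>-dense: since
  \<open>sin (d x) / d \<rightarrow> x\<close>, sums with frequencies near \<open>0\<close> approximate every polynomial, polynomials are \<open>C\<^sup>1\<close>-dense
  (convolution with Landau kernels), and multiplication by an exponential moves the frequencies from \<open>0\<close> to \<open>y\<^sub>t\<close>.\<close>

subsection \<open>Approximation in \<open>C\<^sup>1\<close>\<close>

text \<open>The coefficients \<open>c\<^sub>t\<^sub>i(U)\<close> may grow without bound as
  \<open>U\<close> shrinks, so the functions fed into the transform are not uniformly bounded. What
  stays bounded is the sum over \<open>i\<close> of \<open>|c\<^sub>t\<^sub>i(U)|\<close> times the
  total variation of \<open>\<rho>\<^sub>i\<^sub>s\<close> on \<open>U\<close>, at most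
  \<open>C1 * C2\<close>. On a ball of radius \<open>\<eta>\<close> the kernel and its
  \<open>x\<close>-derivative vary only by \<open>O(\<eta>)\<close>, and this factor gives the
  convergence. Symmetrization yields real parts only if \<open>\<rho>(- U)\<close> is the conjugate
  of \<open>\<rho>(U)\<close>. This is not part of the definition of a spectral measure and is
  derived from the covariance being real. A complex coefficient \<open>a\<close> then covers cosines
  and sines alike. The exponentials with frequencies in one ball are no algebra, since frequencies
  add under multiplication and leave the ball, so a Stone-Weierstrass argument does not apply to
  them directly. Around \<open>0\<close> the remedy is that the radius is arbitrary: each factor of
  a product is approximated with half the radius.\<close>

text \<open>Value and derivative obey the same bound separately, so the sum of the two norms is at
  most \<open>2 * e\<close>. A predicate with a witness derivative replaces a supremum, and
  estimates combine pointwise.\<close>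

definition C1_bound ::
  "'a::real_normed_vector set \<Rightarrow> real \<Rightarrow> ('a \<Rightarrow> 'b::real_normed_vector) \<Rightarrow> bool" where
  "C1_bound B e f \<longleftrightarrow> (\<forall>x\<in>B. norm (f x) \<le> e \<and>
     (\<exists>D. (f has_derivative D) (at x) \<and> (\<forall>v. norm (D v) \<le> e * norm v)))"

text \<open>Only the difference has to be differentiable, and only at points of \<open>B\<close>.
  Since \<open>A\<close> is an arbitrary set, closures can be chained through intermediate families
  by \<open>C1_closure_idem\<close>.\<close>

definition C1_closure ::
  "'a::real_normed_vector set \<Rightarrow> ('a \<Rightarrow> 'b::real_normed_vector) set \<Rightarrow> ('a \<Rightarrow> 'b) set" where
  "C1_closure B A = {f. \<forall>e>0. \<exists>g\<in>A. C1_bound B e (\<lambda>x. g x - f x)}"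

lemma C1_boundI:
  assumes "\<And>x. x \<in> B \<Longrightarrow> norm (f x) \<le> e"
    and "\<And>x. x \<in> B \<Longrightarrow> (f has_derivative D x) (at x)"
    and "\<And>x v. x \<in> B \<Longrightarrow> norm (D x v) \<le> e * norm v"
  shows "C1_bound B e f"
  using assms unfolding C1_bound_def by blast

lemma C1_bound_mono:
  assumes "C1_bound B e f" "e \<le> e'"
  shows "C1_bound B e' f"
proof (unfold C1_bound_def, intro ballI conjI)
  fix x assume x: "x \<in> B"
  with assms obtain D where D: "norm (f x) \<le> e" "(f has_derivative D) (at x)"
    "\<And>v. norm (D v) \<le> e * norm v" unfolding C1_bound_def by blast
  show "norm (f x) \<le> e'" using D(1) assms(2) by simp
  have "norm (D v) \<le> e' * norm v" for v
    using D(3)[of v] mult_right_mono[OF assms(2) norm_ge_zero[of v]] by linarith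
  with D(2) show "\<exists>D. (f has_derivative D) (at x) \<and> (\<forall>v. norm (D v) \<le> e' * norm v)" by blast
qed

lemma C1_bound_subset: "C1_bound B e f \<Longrightarrow> B' \<subseteq> B \<Longrightarrow> C1_bound B' e f"
  unfolding C1_bound_def by blast

lemma C1_bound_zero: "e \<ge> 0 \<Longrightarrow> C1_bound B e (\<lambda>x. 0)"
  by (rule C1_boundI[where D="\<lambda>x v. 0"]) auto

lemma C1_bound_add:
  assumes "C1_bound B e1 f" "C1_bound B e2 g"
  shows "C1_bound B (e1 + e2) (\<lambda>x. f x + g x)"
  unfolding C1_bound_def
proof (intro ballI conjI)
  fix x assume x: "x \<in> B"
  with assms(1) obtain D where D: "norm (f x) \<le> e1" "(f has_derivative D) (at x)"
    "\<And>v. norm (D v) \<le> e1 * norm v" unfolding C1_bound_def by blast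
  from x assms(2) obtain E where E: "norm (g x) \<le> e2" "(g has_derivative E) (at x)"
    "\<And>v. norm (E v) \<le> e2 * norm v" unfolding C1_bound_def by blast
  show "norm (f x + g x) \<le> e1 + e2" using D(1) E(1) by (intro norm_triangle_mono)
  have "norm (D v + E v) \<le> (e1 + e2) * norm v" for v
    using norm_triangle_mono[OF D(3) E(3)] by (simp add: algebra_simps)
  with has_derivative_add[OF D(2) E(2)]
  show "\<exists>D. ((\<lambda>x. f x + g x) has_derivative D) (at x) \<and> (\<forall>v. norm (D v) \<le> (e1 + e2) * norm v)"
    by (intro exI[of _ "\<lambda>v. D v + E v"]) auto
qed

lemma C1_bound_sum:
  assumes "finite I" "\<And>i. i \<in> I \<Longrightarrow> C1_bound B (e i) (f i)"
  shows "C1_bound B (\<Sum>i\<in>I. e i) (\<lambda>x. \<Sum>i\<in>I. f i x)"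
  using assms by (induction I rule: finite_induct) (auto intro: C1_bound_zero C1_bound_add)

lemma C1_bound_linear:
  assumes T: "bounded_linear T" and K: "\<And>z. norm (T z) \<le> K * norm z" and "K \<ge> 0"
    and f: "C1_bound B e f"
  shows "C1_bound B (K * e) (\<lambda>x. T (f x))"
  unfolding C1_bound_def
proof (intro ballI conjI)
  fix x assume x: "x \<in> B"
  with f obtain D where D: "norm (f x) \<le> e" "(f has_derivative D) (at x)"
    "\<And>v. norm (D v) \<le> e * norm v" unfolding C1_bound_def by blast
  show "norm (T (f x)) \<le> K * e"
    using K[of "f x"] mult_left_mono[OF D(1) \<open>K \<ge> 0\<close>] by linarith
  have "norm (T (D v)) \<le> K * e * norm v" for v
    using K[of "D v"] mult_left_mono[OF D(3)[of v] \<open>K \<ge> 0\<close>] by (simp add: mult.assoc)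
  with bounded_linear.has_derivative[OF T D(2)]
  show "\<exists>D. ((\<lambda>x. T (f x)) has_derivative D) (at x) \<and> (\<forall>v. norm (D v) \<le> K * e * norm v)"
    by blast
qed

text \<open>The factor 2 comes from the product rule: both of its terms are at most
  \<open>e1 * e2 * norm v\<close>.\<close>

lemma C1_bound_mult:
  fixes f g :: "'a::real_normed_vector \<Rightarrow> 'b::real_normed_algebra"
  assumes "C1_bound B e1 f" "C1_bound B e2 g" "e1 \<ge> 0" "e2 \<ge> 0"
  shows "C1_bound B (2 * e1 * e2) (\<lambda>x. f x * g x)"
  unfolding C1_bound_def
proof (intro ballI conjI)
  fix x assume x: "x \<in> B"
  with assms(1) obtain D where D: "norm (f x) \<le> e1" "(f has_derivative D) (at x)"
    "\<And>v. norm (D v) \<le> e1 * norm v" unfolding C1_bound_def by blast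
  from x assms(2) obtain E where E: "norm (g x) \<le> e2" "(g has_derivative E) (at x)"
    "\<And>v. norm (E v) \<le> e2 * norm v" unfolding C1_bound_def by blast
  have "norm (f x * g x) \<le> e1 * e2"
    using norm_mult_ineq[of "f x" "g x"] mult_mono[OF D(1) E(1)] assms(3) by simp
  also have "\<dots> \<le> 2 * e1 * e2" using assms(3,4) by simp
  finally show "norm (f x * g x) \<le> 2 * e1 * e2" .
  have "norm (f x * E v + D v * g x) \<le> 2 * e1 * e2 * norm v" for v
  proof -
    have "norm (f x * E v) \<le> e1 * (e2 * norm v)"
      using norm_mult_ineq[of "f x" "E v"] mult_mono[OF D(1) E(3)[of v]] assms(3) by simp
    moreover have "norm (D v * g x) \<le> (e1 * norm v) * e2"
      using norm_mult_ineq[of "D v" "g x"] mult_mono[OF D(3)[of v] E(1)] assms(3) by simp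
    ultimately have "norm (f x * E v + D v * g x) \<le> e1 * (e2 * norm v) + (e1 * norm v) * e2"
      by (rule norm_triangle_mono)
    thus ?thesis by (simp add: algebra_simps)
  qed
  with has_derivative_mult[OF D(2) E(2)]
  show "\<exists>D. ((\<lambda>x. f x * g x) has_derivative D) (at x) \<and> (\<forall>v. norm (D v) \<le> 2 * e1 * e2 * norm v)"
    by blast
qed

text \<open>By monotonicity in \<open>e\<close> only small tolerances matter. The bound
  \<open>e < 1\<close> serves \<open>C1_closure_mult\<close>, where it keeps the quadratic error
  term below the linear one.\<close>

lemma C1_closureI:
  assumes "\<And>e. e > 0 \<Longrightarrow> e < 1 \<Longrightarrow> \<exists>g\<in>A. C1_bound B e (\<lambda>x. g x - f x)"
  shows "f \<in> C1_closure B A"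
  unfolding C1_closure_def
proof safe
  fix e :: real assume "e > 0"
  then obtain g where g: "g \<in> A" "C1_bound B (min e (1/2)) (\<lambda>x. g x - f x)"
    using assms[of "min e (1/2)"] by fastforce
  thus "\<exists>g\<in>A. C1_bound B e (\<lambda>x. g x - f x)" using C1_bound_mono[OF g(2), of e] by auto
qed

lemma C1_closureE:
  assumes "f \<in> C1_closure B A" "e > 0"
  obtains g where "g \<in> A" "C1_bound B e (\<lambda>x. g x - f x)"
  using assms unfolding C1_closure_def by blast

lemma subset_C1_closure: "f \<in> A \<Longrightarrow> f \<in> C1_closure B A"
  by (rule C1_closureI) (auto intro!: bexI[of _ f] C1_bound_zero)

lemma C1_closure_subset: "f \<in> C1_closure K A \<Longrightarrow> B \<subseteq> K \<Longrightarrow> f \<in> C1_closure B A"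
  unfolding C1_closure_def using C1_bound_subset by blast

lemma C1_closure_idem:
  assumes "f \<in> C1_closure B A" "A \<subseteq> C1_closure B A'"
  shows "f \<in> C1_closure B A'"
proof (rule C1_closureI)
  fix e :: real assume e: "e > 0"
  then obtain g where g: "g \<in> A" "C1_bound B (e/2) (\<lambda>x. g x - f x)"
    using C1_closureE[OF assms(1)] by (metis half_gt_zero)
  then obtain k where k: "k \<in> A'" "C1_bound B (e/2) (\<lambda>x. k x - g x)"
    using assms(2) C1_closureE e by (metis half_gt_zero subset_iff)
  have "C1_bound B (e/2 + e/2) (\<lambda>x. (k x - g x) + (g x - f x))"
    by (rule C1_bound_add[OF k(2) g(2)])
  with k(1) show "\<exists>g\<in>A'. C1_bound B e (\<lambda>x. g x - f x)" by auto
qed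

lemma C1_closure_add:
  assumes f: "f \<in> C1_closure B A" and g: "g \<in> C1_closure B A'"
    and A: "\<And>u v. u \<in> A \<Longrightarrow> v \<in> A' \<Longrightarrow> (\<lambda>x. u x + v x) \<in> A''"
  shows "(\<lambda>x. f x + g x) \<in> C1_closure B A''"
proof (rule C1_closureI)
  fix e :: real assume e: "e > 0"
  then obtain u where u: "u \<in> A" "C1_bound B (e/2) (\<lambda>x. u x - f x)"
    using C1_closureE[OF f] by (metis half_gt_zero)
  obtain v where v: "v \<in> A'" "C1_bound B (e/2) (\<lambda>x. v x - g x)"
    using C1_closureE[OF g] e by (metis half_gt_zero)
  have "C1_bound B (e/2 + e/2) (\<lambda>x. (u x - f x) + (v x - g x))"
    by (rule C1_bound_add[OF u(2) v(2)])
  with A[OF u(1) v(1)] show "\<exists>k\<in>A''. C1_bound B e (\<lambda>x. k x - (f x + g x))"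
    by (intro bexI[of _ "\<lambda>x. u x + v x"]) (auto simp: algebra_simps)
qed

lemma C1_closure_mult:
  fixes f g :: "'a::real_normed_vector \<Rightarrow> 'b::real_normed_algebra"
  assumes f: "f \<in> C1_closure B A" "C1_bound B M f"
    and g: "g \<in> C1_closure B A'" "C1_bound B M' g"
    and A: "\<And>u v. u \<in> A \<Longrightarrow> v \<in> A' \<Longrightarrow> (\<lambda>x. u x * v x) \<in> A''"
  shows "(\<lambda>x. f x * g x) \<in> C1_closure B A''"
proof (rule C1_closureI)
  fix e :: real assume e: "e > 0" "e < 1"
  define N where "N = max 1 (max M M')"
  have N: "N \<ge> 1" "C1_bound B N f" "C1_bound B N g"
    unfolding N_def by (auto intro!: C1_bound_mono[OF f(2)] C1_bound_mono[OF g(2)])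
  \<comment> \<open>The total error will be \<open>2 * d * (d + 2 * N)\<close>, which is at most
    \<open>6 * N * d\<close> because \<open>d \<le> 1 \<le> N\<close>.\<close>
  define d where "d = e / (6 * N)"
  have "e * 1 \<le> e * N" using e N by (intro mult_left_mono) auto
  hence d: "d > 0" "d \<le> 1" using e N(1) by (auto simp: d_def field_simps)
  obtain u where u: "u \<in> A" "C1_bound B d (\<lambda>x. u x - f x)" using C1_closureE[OF f(1) d(1)] by blast
  obtain v where v: "v \<in> A'" "C1_bound B d (\<lambda>x. v x - g x)" using C1_closureE[OF g(1) d(1)] by blast
  \<comment> \<open>Writing \<open>v\<close> as \<open>(v - g) + g\<close> bounds the approximant
    without any assumption on the members of \<open>A'\<close>.\<close>
  have vN: "C1_bound B (d + N) (\<lambda>x. (v x - g x) + g x)" by (rule C1_bound_add[OF v(2) N(3)])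
  have "C1_bound B (2 * d * (d + N) + 2 * N * d) (\<lambda>x. (u x - f x) * ((v x - g x) + g x) + f x * (v x - g x))"
    using d N by (intro C1_bound_add C1_bound_mult u vN N v) auto
  moreover have "(\<lambda>x. (u x - f x) * ((v x - g x) + g x) + f x * (v x - g x)) = (\<lambda>x. u x * v x - f x * g x)"
    by (auto simp: algebra_simps)
  moreover have "2 * d * (d + N) + 2 * N * d \<le> e"
  proof -
    have "2 * d * (d + N) + 2 * N * d = 2 * d * (d + 2 * N)" by (simp add: algebra_simps)
    also have "\<dots> \<le> 2 * d * (3 * N)" using d N by (intro mult_left_mono) auto
    also have "\<dots> = e" using N by (simp add: d_def)
    finally show ?thesis .
  qed
  ultimately have "C1_bound B e (\<lambda>x. u x * v x - f x * g x)" using C1_bound_mono by metis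
  with A[OF u(1) v(1)] show "\<exists>k\<in>A''. C1_bound B e (\<lambda>x. k x - f x * g x)"
    by (intro bexI[of _ "\<lambda>x. u x * v x"])
qed

lemma C1_closure_linear:
  assumes T: "bounded_linear T"
    and f: "f \<in> C1_closure B A"
    and A: "\<And>u. u \<in> A \<Longrightarrow> (\<lambda>x. T (u x)) \<in> A'"
  shows "(\<lambda>x. T (f x)) \<in> C1_closure B A'"
proof (rule C1_closureI)
  fix e :: real assume e: "e > 0"
  obtain K where K: "K > 0" "\<And>z. norm (T z) \<le> K * norm z"
    using bounded_linear.pos_bounded[OF T] by (auto simp: mult.commute)
  obtain u where u: "u \<in> A" "C1_bound B (e/K) (\<lambda>x. u x - f x)"
    using C1_closureE[OF f, of "e/K"] e K by auto
  have "C1_bound B (K * (e/K)) (\<lambda>x. T (u x - f x))"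
    using K u(2) by (intro C1_bound_linear T) auto
  thus "\<exists>k\<in>A'. C1_bound B e (\<lambda>x. k x - T (f x))" using A[OF u(1)] K
    by (intro bexI[of _ "\<lambda>x. T (u x)"]) (auto simp: bounded_linear.linear[OF T] linear_diff)
qed

lemma C1_closure_sum:
  assumes "\<And>t. t \<in> I \<Longrightarrow> f t \<in> C1_closure B A" "finite I"
    and zero: "(\<lambda>x. 0) \<in> A" and add: "\<And>u v. u \<in> A \<Longrightarrow> v \<in> A \<Longrightarrow> (\<lambda>x. u x + v x) \<in> A"
  shows "(\<lambda>x. \<Sum>t\<in>I. f t x) \<in> C1_closure B A"
  using assms(2,1)
proof (induction I rule: finite_induct)
  case empty
  show ?case using subset_C1_closure[OF zero] by simp
next
  case (insert t I)
  have "(\<lambda>x. f t x + (\<Sum>t\<in>I. f t x)) \<in> C1_closure B A"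
    using insert by (intro C1_closure_add[where A=A and A'=A] add) auto
  with insert show ?case by simp
qed

subsection \<open>Polynomials are \<open>C\<^sup>1\<close>-dense\<close>

text \<open>Squaring removes the kink of the positive part at \<open>0\<close>, where the difference
  quotient is at most \<open>|h|\<close>. This function is the only building block of the cutoff:
  once for the bumps, once to level their sum off at 1.\<close>

lemma has_real_derivative_max0_squared:
  "((\<lambda>u::real. (max 0 u)\<^sup>2) has_real_derivative 2 * max 0 u) (at u)"
proof (cases "u = 0")
  case True
  have "((\<lambda>h. ((max 0 h)\<^sup>2) / h) \<longlongrightarrow> 0) (at (0::real))"
  proof (rule Lim_null_comparison)
    show "\<forall>\<^sub>F h in at 0. norm ((max 0 h)\<^sup>2 / h) \<le> \<bar>h::real\<bar>"
      by (auto intro!: always_eventually simp: max_def power2_eq_square)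
    show "((\<lambda>h::real. \<bar>h\<bar>) \<longlongrightarrow> 0) (at 0)" by (rule tendsto_rabs_zero) simp
  qed
  thus ?thesis using True by (simp add: DERIV_def)
next
  case False
  show ?thesis
  proof (cases "u > 0")
    case True
    have "((\<lambda>u::real. u\<^sup>2) has_real_derivative 2 * max 0 u) (at u)"
      using True by (auto intro!: derivative_eq_intros)
    thus ?thesis
      by (rule DERIV_cong_ev[THEN iffD1, rotated -1])
        (use True in \<open>auto simp: eventually_nhds intro!: exI[of _ "{0<..}"]\<close>)
  next
    case neg: False
    have "((\<lambda>u::real. 0) has_real_derivative 2 * max 0 u) (at u)"
      using neg by (auto intro!: derivative_eq_intros)
    thus ?thesis
      by (rule DERIV_cong_ev[THEN iffD1, rotated -1])
        (use neg False in \<open>auto simp: eventually_nhds intro!: exI[of _ "{..<0}"]\<close>)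
  qed
qed

text \<open>Finitely many bumps, each the squared positive part of
  \<open>(d p)\<^sup>2 - |x - p|\<^sup>2\<close>, cover \<open>K\<close>. Their sum \<open>s\<close>
  exceeds some \<open>c > 0\<close> on \<open>K\<close>, and
  \<open>1 - (max 0 (1 - s / c))\<^sup>2\<close> equals 1 where \<open>s > c\<close> and 0 where
  \<open>s = 0\<close>.\<close>

lemma C1_cutoff:
  fixes K S :: "'a::euclidean_space set"
  assumes K: "compact K" and S: "open S" "K \<subseteq> S"
  obtains \<psi> :: "'a \<Rightarrow> real" and \<psi>' V L where "open V" "K \<subseteq> V" "compact L" "L \<subseteq> S"
    "\<And>x. (\<psi> has_derivative blinfun_apply (\<psi>' x)) (at x)" "continuous_on UNIV \<psi>'"
    "\<And>x. x \<in> V \<Longrightarrow> \<psi> x = 1" "\<And>x. x \<notin> L \<Longrightarrow> \<psi> x = 0"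
proof -
  have "\<forall>x\<in>S. \<exists>d>0. cball x d \<subseteq> S" using S(1) by (simp add: open_contains_cball)
  then obtain d where d: "\<And>x. x \<in> S \<Longrightarrow> d x > 0" "\<And>x. x \<in> S \<Longrightarrow> cball x (d x) \<subseteq> S" by metis
  obtain T where T: "T \<subseteq> K" "finite T" "K \<subseteq> (\<Union>x\<in>T. ball x (d x))"
  proof (rule compactE_image[OF K, of K "\<lambda>x. ball x (d x)"])
    show "K \<subseteq> (\<Union>x\<in>K. ball x (d x))" using d(1) S(2) by force
  qed auto
  define b where "b p x = (max 0 ((d p)\<^sup>2 - (x - p) \<bullet> (x - p)))\<^sup>2" for p x
  define b' where "b' p x = (2 * max 0 ((d p)\<^sup>2 - (x - p) \<bullet> (x - p))) *\<^sub>R (- 2 *\<^sub>R blinfun_inner_right (x - p))" for p x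
  have b': "(b p has_derivative blinfun_apply (b' p x)) (at x)" for p x
  proof -
    have 1: "((\<lambda>x. (d p)\<^sup>2 - (x - p) \<bullet> (x - p)) has_derivative (\<lambda>v. - 2 * ((x - p) \<bullet> v))) (at x)"
      by (auto intro!: derivative_eq_intros simp: inner_commute algebra_simps)
    have 2: "((\<lambda>x. (max 0 ((d p)\<^sup>2 - (x - p) \<bullet> (x - p)))\<^sup>2) has_derivative
       (\<lambda>v. (- 2 * ((x - p) \<bullet> v)) * (2 * max 0 ((d p)\<^sup>2 - (x - p) \<bullet> (x - p))))) (at x)"
      using has_derivative_compose[OF 1 has_real_derivative_max0_squared[unfolded has_field_derivative_def]]
      by (simp add: mult.commute)
    have 3: "blinfun_apply (b' p x) = (\<lambda>v. (- 2 * ((x - p) \<bullet> v)) * (2 * max 0 ((d p)\<^sup>2 - (x - p) \<bullet> (x - p))))"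
      unfolding b'_def by (auto simp: scaleR_blinfun.rep_eq uminus_blinfun.rep_eq fun_eq_iff)
    show ?thesis using 2 unfolding 3 b_def .
  qed
  have cont_b': "continuous_on UNIV (b' p)" for p
    unfolding b'_def by (intro continuous_intros bounded_linear.continuous_on[OF bounded_linear_blinfun_inner_right])
  have b_nonneg: "b p x \<ge> 0" for p x by (simp add: b_def)
  define s where "s x = (\<Sum>p\<in>T. b p x)" for x
  define s' where "s' x = (\<Sum>p\<in>T. b' p x)" for x
  have s': "(s has_derivative blinfun_apply (s' x)) (at x)" for x
  proof -
    have "(s has_derivative (\<lambda>v. \<Sum>p\<in>T. blinfun_apply (b' p x) v)) (at x)"
      unfolding s_def by (intro has_derivative_sum b')
    moreover have "blinfun_apply (s' x) = (\<lambda>v. \<Sum>p\<in>T. blinfun_apply (b' p x) v)"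
      by (rule ext) (simp add: s'_def blinfun.sum_left)
    ultimately show ?thesis by simp
  qed
  have cont_s': "continuous_on UNIV s'" unfolding s'_def by (intro continuous_intros cont_b')
  have cont_s: "continuous_on A s" for A
    using s' has_derivative_continuous continuous_at_imp_continuous_on by blast
  have s_pos: "s x > 0" if x: "x \<in> K" for x
  proof -
    obtain p where p: "p \<in> T" "x \<in> ball p (d p)" using T(3) x by blast
    have "norm (x - p) < d p" using p(2) by (simp add: dist_norm norm_minus_commute)
    hence "(norm (x - p))\<^sup>2 < (d p)\<^sup>2" by (intro power_strict_mono) auto
    hence "b p x > 0" by (auto simp: b_def power2_norm_eq_inner)
    thus ?thesis unfolding s_def using p(1) T(2) b_nonneg by (intro sum_pos2) auto
  qed
  \<comment> \<open>Half of the minimum on \<open>K\<close> is taken so that the inequality is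
    strict and \<open>{x. s x > c}\<close> is an open neighbourhood of \<open>K\<close>.\<close>
  have "\<exists>c>0. \<forall>x\<in>K. s x > c"
  proof (cases "K = {}")
    case False
    then obtain x0 where x0: "x0 \<in> K" "\<And>x. x \<in> K \<Longrightarrow> s x0 \<le> s x"
      using continuous_attains_inf[OF K False cont_s] by blast
    show ?thesis using s_pos[OF x0(1)] x0 by (intro exI[of _ "s x0 / 2"]) force
  qed (auto intro: exI[of _ 1])
  then obtain c where c: "c > 0" "\<And>x. x \<in> K \<Longrightarrow> s x > c" by blast
  define V where "V = {x. s x > c}"
  define L where "L = (\<Union>p\<in>T. cball p (d p))"
  define \<psi> where "\<psi> x = 1 - (max 0 (1 - s x / c))\<^sup>2" for x
  define \<psi>' where "\<psi>' x = (2 * max 0 (1 - s x / c) / c) *\<^sub>R s' x" for x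
  show ?thesis
  proof
    show "open V" unfolding V_def by (intro open_Collect_less cont_s continuous_intros)
    show "K \<subseteq> V" using c by (auto simp: V_def)
    show "compact L" unfolding L_def using T(2) by (intro compact_UN) auto
    show "L \<subseteq> S" unfolding L_def using d(2) T(1) S(2) by blast
    show "(\<psi> has_derivative blinfun_apply (\<psi>' x)) (at x)" for x
    proof -
      have 1: "((\<lambda>x. 1 - s x / c) has_derivative (\<lambda>v. - (s' x v / c))) (at x)"
        using c(1) by (auto intro!: derivative_eq_intros s')
      have "((\<lambda>x. (max 0 (1 - s x / c))\<^sup>2) has_derivative
           (\<lambda>v. 2 * max 0 (1 - s x / c) * - (s' x v / c))) (at x)"
        using has_derivative_compose[OF 1 has_real_derivative_max0_squared[unfolded has_field_derivative_def]] .
      from has_derivative_diff[OF has_derivative_const[of 1] this]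
      have "((\<lambda>x. 1 - (max 0 (1 - s x / c))\<^sup>2) has_derivative
           (\<lambda>v. 2 * max 0 (1 - s x / c) / c * s' x v)) (at x)" by simp
      thus ?thesis unfolding \<psi>_def \<psi>'_def by (simp add: scaleR_blinfun.rep_eq)
    qed
    show "continuous_on UNIV \<psi>'" unfolding \<psi>'_def
      by (intro continuous_intros cont_s cont_s') (use c(1) in auto)
    show "\<psi> x = 1" if "x \<in> V" for x
      using that c(1) by (auto simp: \<psi>_def V_def field_simps max_def)
    show "\<psi> x = 0" if "x \<notin> L" for x
    proof -
      have "b p x = 0" if "p \<in> T" for p
      proof -
        have "norm (x - p) > d p" using \<open>x \<notin> L\<close> that by (auto simp: L_def dist_norm norm_minus_commute)
        hence "(norm (x - p))\<^sup>2 \<ge> (d p)\<^sup>2" using d(1)[of p] T(1) S(2) that by (intro power_mono) force+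
        thus ?thesis by (simp add: b_def power2_norm_eq_inner)
      qed
      hence "s x = 0" by (simp add: s_def)
      thus ?thesis by (simp add: \<psi>_def)
    qed
  qed
qed

text \<open>The product of \<open>g\<close> with a cutoff is continued by \<open>0\<close>. The open
  sets \<open>S\<close> and \<open>- L\<close> cover the space because
  \<open>L \<subseteq> S\<close>, and on each of them the derivative is explicit, so
  differentiability and continuity of \<open>G'\<close> are local checks.\<close>

lemma C1_compact_support_extension:
  fixes g :: "'a::euclidean_space \<Rightarrow> real"
  assumes K: "compact K" and S: "open S" "K \<subseteq> S"
    and g: "\<And>x. x \<in> S \<Longrightarrow> (g has_derivative blinfun_apply (g' x)) (at x)" "continuous_on S g'"
  obtains G G' V L where "open V" "K \<subseteq> V" "compact L"
    "\<And>x. (G has_derivative blinfun_apply (G' x)) (at x)" "continuous_on UNIV G'"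
    "\<And>x. x \<in> V \<Longrightarrow> G x = g x" "\<And>x. x \<notin> L \<Longrightarrow> G x = 0"
proof -
  obtain \<psi> :: "'a \<Rightarrow> real" and \<psi>' V L where c: "open V" "K \<subseteq> V" "compact L" "L \<subseteq> S"
    "\<And>x. (\<psi> has_derivative blinfun_apply (\<psi>' x)) (at x)" "continuous_on UNIV \<psi>'"
    "\<And>x. x \<in> V \<Longrightarrow> \<psi> x = 1" "\<And>x. x \<notin> L \<Longrightarrow> \<psi> x = 0"
    by (rule C1_cutoff[OF K S]) (rule that)
  define G where "G x = (if x \<in> S then \<psi> x * g x else 0)" for x
  define G' where "G' x = (if x \<in> S then \<psi> x *\<^sub>R g' x + g x *\<^sub>R \<psi>' x else 0)" for x
  have openL: "open (- L)" using c(3) by (simp add: compact_imp_closed open_Compl)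
  have G0: "G x = 0" if "x \<notin> L" for x using c(8)[OF that] by (simp add: G_def)
  have \<psi>0: "\<psi>' x = 0" if "x \<notin> L" for x
  proof -
    have "((\<lambda>x. 0) has_derivative blinfun_apply (\<psi>' x)) (at x)"
      by (rule has_derivative_transform_within_open[OF c(5) openL]) (use that c(8) in auto)
    hence "blinfun_apply (\<psi>' x) = (\<lambda>v. 0)" by (metis has_derivative_const has_derivative_unique)
    thus ?thesis by (intro blinfun_eqI) auto
  qed
  have G'0: "G' x = 0" if "x \<notin> L" for x using c(8)[OF that] \<psi>0[OF that] by (simp add: G'_def)
  show ?thesis
  proof
    show "open (V \<inter> S)" using c(1) S(1) by blast
    show "K \<subseteq> V \<inter> S" using c(2) S(2) by blast
    show "compact L" by fact
    show "G x = 0" if "x \<notin> L" for x using G0[OF that] .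
    show "G x = g x" if "x \<in> V \<inter> S" for x using that c(7) by (simp add: G_def)
    show "(G has_derivative blinfun_apply (G' x)) (at x)" for x
    proof (cases "x \<in> S")
      case True
      have "((\<lambda>x. \<psi> x * g x) has_derivative (\<lambda>v. \<psi> x * g' x v + \<psi>' x v * g x)) (at x)"
        by (rule has_derivative_mult[OF c(5) g(1)[OF True]])
      moreover have "blinfun_apply (G' x) = (\<lambda>v. \<psi> x * g' x v + \<psi>' x v * g x)"
        using True by (auto simp: G'_def plus_blinfun.rep_eq scaleR_blinfun.rep_eq fun_eq_iff)
      ultimately have "((\<lambda>x. \<psi> x * g x) has_derivative blinfun_apply (G' x)) (at x)" by simp
      thus ?thesis by (rule has_derivative_transform_within_open[OF _ S(1) True]) (auto simp: G_def)
    next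
      case False
      hence x: "x \<in> - L" using c(4) by auto
      have "((\<lambda>x. 0) has_derivative blinfun_apply (G' x)) (at x)" using G'0 x by (auto simp: zero_blinfun.rep_eq)
      thus ?thesis by (rule has_derivative_transform_within_open[OF _ openL x]) (auto simp: G0)
    qed
    have "continuous_on (S \<union> - L) G'"
    proof (rule continuous_on_open_Un[OF S(1) openL])
      have "continuous_on S g" using g(1) has_derivative_continuous continuous_at_imp_continuous_on by blast
      moreover have "continuous_on S \<psi>" using c(5) has_derivative_continuous continuous_at_imp_continuous_on by blast
      ultimately have "continuous_on S (\<lambda>x. \<psi> x *\<^sub>R g' x + g x *\<^sub>R \<psi>' x)"
        using continuous_on_subset[OF c(6)] by (intro continuous_intros g(2)) auto
      thus "continuous_on S G'" by (rule continuous_on_eq) (auto simp: G'_def)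
      show "continuous_on (- L) G'"
        by (rule continuous_on_eq[OF continuous_on_const[of _ 0]]) (auto simp: G'0)
    qed
    moreover have "S \<union> - L = UNIV" using c(4) by blast
    ultimately show "continuous_on UNIV G'" by simp
  qed
qed

section \<open>Landau kernels and polynomial convolution\<close>

text \<open>Beyond radius \<open>d\<close> the kernel is at most \<open>\<theta> ^ k\<close>, while
  on a smaller box inside the ball of radius \<open>d / 2\<close> it is at least
  \<open>\<theta>' ^ k\<close> with \<open>\<theta>' > \<theta>\<close>. Normalization therefore
  leaves at most \<open>(\<theta> / \<theta>') ^ k / m\<close>, where \<open>m\<close> is the volume
  of that box.\<close>

lemma landau_kernel_concentrates:
  fixes a :: "'a::euclidean_space"
  assumes a: "\<And>b. b \<in> Basis \<Longrightarrow> a \<bullet> b > 0" and D: "D > 0" "\<And>z. z \<in> cbox (-a) a \<Longrightarrow> norm z \<le> D"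
    and d: "0 < d" "d \<le> D"
  defines "I \<equiv> \<lambda>k. integral (cbox (-a) a) (\<lambda>z. (1 - (norm z)\<^sup>2 / D\<^sup>2) ^ k)"
  shows "I k > 0" "(\<lambda>k. (1 - d\<^sup>2 / D\<^sup>2) ^ k / I k) \<longlonglongrightarrow> 0"
proof -
  \<comment> \<open>Scaling by \<open>t\<close> keeps the small box within the large one
    (\<open>t \<le> 1\<close>) and within distance \<open>d / 2\<close> of the origin
    (\<open>t * D \<le> d / 2\<close>).\<close>
  define t where "t = min 1 (d / (2 * D))"
  have t: "0 < t" "t \<le> 1" "t * D \<le> d / 2"
    using d D by (auto simp: t_def min_def field_simps)
  define b where "b = t *\<^sub>R a"
  define \<theta> where "\<theta> = 1 - d\<^sup>2 / D\<^sup>2"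
  define \<theta>' where "\<theta>' = 1 - d\<^sup>2 / (4 * D\<^sup>2)"
  have \<theta>: "0 \<le> \<theta>" "\<theta> < \<theta>'" "0 < \<theta>'"
  proof -
    have "d\<^sup>2 \<le> D\<^sup>2" using d by (intro power_mono) auto
    thus "0 \<le> \<theta>" using D by (simp add: \<theta>_def)
    show "\<theta> < \<theta>'" using d D by (simp add: \<theta>_def \<theta>'_def field_simps)
    with \<open>0 \<le> \<theta>\<close> show "0 < \<theta>'" by simp
  qed
  have bz: "z \<in> cbox (-a) a \<and> norm z \<le> d / 2" if z: "z \<in> cbox (-b) b" for z
  proof -
    have "(1/t) *\<^sub>R z \<in> cbox (-a) a" using z t(1) by (auto simp: mem_box b_def field_simps)
    hence "norm z \<le> t * D" using D(2)[of "(1/t) *\<^sub>R z"] t(1) by (simp add: field_simps)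
    moreover have "z \<in> cbox (-a) a"
      unfolding mem_box
    proof
      fix i :: 'a assume i: "i \<in> Basis"
      have "t * (a \<bullet> i) \<le> 1 * (a \<bullet> i)" using t a[OF i] by (intro mult_right_mono) auto
      thus "- a \<bullet> i \<le> z \<bullet> i \<and> z \<bullet> i \<le> a \<bullet> i" using z i unfolding mem_box b_def by fastforce
    qed
    ultimately show ?thesis using t by simp
  qed
  define m where "m = measure lborel (cbox (-b) b)"
  have m: "m > 0" unfolding m_def using a t(1) by (intro content_pos_lt) (auto simp: b_def)
  have cont: "continuous_on A (\<lambda>z. (1 - (norm z)\<^sup>2 / D\<^sup>2) ^ k)" for A :: "'a set" and k
    using D(1) by (intro continuous_intros) auto
  have I: "I k \<ge> m * \<theta>' ^ k" for k
  proof -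
    have "m * \<theta>' ^ k = integral (cbox (-b) b) (\<lambda>z. \<theta>' ^ k)" by (simp add: m_def)
    also have "\<dots> \<le> integral (cbox (-b) b) (\<lambda>z. (1 - (norm z)\<^sup>2 / D\<^sup>2) ^ k)"
    proof (rule integral_le)
      fix z assume "z \<in> cbox (-b) b"
      hence "(norm z)\<^sup>2 \<le> (d / 2)\<^sup>2" using bz by (intro power_mono) auto
      hence "\<theta>' \<le> 1 - (norm z)\<^sup>2 / D\<^sup>2" using D(1) by (simp add: \<theta>'_def field_simps)
      thus "\<theta>' ^ k \<le> (1 - (norm z)\<^sup>2 / D\<^sup>2) ^ k" using \<theta> by (intro power_mono) auto
    qed (auto intro!: integrable_continuous cont)
    also have "\<dots> \<le> I k" unfolding I_def
    proof (rule integral_subset_le; (intro ballI)?)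
      fix z assume "z \<in> cbox (-a) a"
      hence "(norm z)\<^sup>2 \<le> D\<^sup>2" using D(2) by (intro power_mono) auto
      thus "0 \<le> (1 - (norm z)\<^sup>2 / D\<^sup>2) ^ k" using D(1) by (intro zero_le_power) auto
    qed (use bz in \<open>auto intro!: integrable_continuous cont\<close>)
    finally show ?thesis .
  qed
  moreover have mk: "m * \<theta>' ^ k > 0" for k using m \<theta> by simp
  ultimately show "I k > 0" by (meson less_le_trans)
  show "(\<lambda>k. (1 - d\<^sup>2 / D\<^sup>2) ^ k / I k) \<longlonglongrightarrow> 0"
  proof (rule Lim_null_comparison)
    show "\<forall>\<^sub>F k in sequentially. norm ((1 - d\<^sup>2 / D\<^sup>2) ^ k / I k) \<le> (\<theta> / \<theta>') ^ k / m"
    proof (intro always_eventually allI)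
      fix k
      have "norm ((1 - d\<^sup>2 / D\<^sup>2) ^ k / I k) = \<theta> ^ k / I k"
        using \<theta> \<open>\<And>k. I k \<ge> m * \<theta>' ^ k\<close>[of k] mk[of k] by (auto simp: \<theta>_def[symmetric])
      also have "\<dots> \<le> \<theta> ^ k / (m * \<theta>' ^ k)" using I[of k] mk[of k] \<theta> by (intro divide_left_mono) auto
      also have "\<dots> = (\<theta> / \<theta>') ^ k / m" by (simp add: power_divide)
      finally show "norm ((1 - d\<^sup>2 / D\<^sup>2) ^ k / I k) \<le> (\<theta> / \<theta>') ^ k / m" .
    qed
    have "(\<lambda>k. (\<theta> / \<theta>') ^ k) \<longlonglongrightarrow> 0" using \<theta> by (intro LIMSEQ_realpow_zero) auto
    from tendsto_divide[OF this tendsto_const[of m]] m show "(\<lambda>k. (\<theta> / \<theta>') ^ k / m) \<longlonglongrightarrow> 0" by simp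
  qed
qed

text \<open>Near \<open>z = 0\<close> uniform continuity of \<open>u\<close> gives
  \<open>e / 2\<close>, and elsewhere the normalized kernel is negligible. The values lie in a
  Banach space so that the estimate applies both to a function and to its
  \<open>blinfun\<close>-valued derivative.\<close>

lemma landau_kernel_approximate_identity:
  fixes a :: "'a::euclidean_space" and u :: "'a \<Rightarrow> 'b::banach"
  assumes a: "\<And>b. b \<in> Basis \<Longrightarrow> a \<bullet> b > 0" and D: "D > 0" "\<And>z. z \<in> cbox (-a) a \<Longrightarrow> norm z \<le> D"
    and u: "continuous_on UNIV u" and X: "bounded X" and e: "e > 0"
  defines "I \<equiv> \<lambda>k. integral (cbox (-a) a) (\<lambda>z. (1 - (norm z)\<^sup>2 / D\<^sup>2) ^ k)"
  shows "\<forall>\<^sub>F k in sequentially. \<forall>x\<in>X. norm ((1 / I k) *\<^sub>R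
    integral (cbox (-a) a) (\<lambda>z. (1 - (norm z)\<^sup>2 / D\<^sup>2) ^ k *\<^sub>R u (x - z)) - u x) \<le> e"
proof -
  define Q where "Q = cbox (-a) a"
  define q where "q z = 1 - (norm z)\<^sup>2 / D\<^sup>2" for z :: 'a
  have q01: "0 \<le> q z" "q z \<le> 1" if "z \<in> Q" for z
  proof -
    have "(norm z)\<^sup>2 \<le> D\<^sup>2" using D(2) that by (intro power_mono) (auto simp: Q_def)
    thus "0 \<le> q z" "q z \<le> 1" using D(1) by (auto simp: q_def)
  qed
  have cont_q: "continuous_on A (\<lambda>z. q z ^ k)" for A k
    unfolding q_def using D(1) by (intro continuous_intros) auto
  have u': "continuous_on A u" for A using u continuous_on_subset by blast
  have cont_ux: "continuous_on A (\<lambda>z. u (x - z))" for A x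
    by (intro continuous_on_compose2[OF u] continuous_intros) auto
  \<comment> \<open>One compact set holding every point at which \<open>u\<close> is evaluated. It
    supplies the bound \<open>M\<close> and a modulus of continuity uniform in
    \<open>x\<close>.\<close>
  define Y where "Y = {x - z |x z. x \<in> closure X \<and> z \<in> Q}"
  have Y: "compact Y" unfolding Y_def using X by (intro compact_differences) (auto simp: Q_def)
  have zQ: "0 \<in> Q" using a by (auto simp: Q_def mem_box less_imp_le)
  have XY: "x \<in> Y" "z \<in> Q \<Longrightarrow> x - z \<in> Y" if "x \<in> X" for x z
  proof -
    have "x \<in> closure X" using that closure_subset by blast
    thus "z \<in> Q \<Longrightarrow> x - z \<in> Y" unfolding Y_def by blast
    have "x = x - 0" by simp
    with \<open>x \<in> closure X\<close> zQ show "x \<in> Y" unfolding Y_def by blast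
  qed
  obtain M where M: "M > 0" "\<And>y. y \<in> Y \<Longrightarrow> norm (u y) \<le> M"
    using compact_imp_bounded[OF compact_continuous_image[OF u' Y]]
    by (auto simp: bounded_pos)
  obtain d0 where d0: "d0 > 0" "\<And>y y'. y \<in> Y \<Longrightarrow> y' \<in> Y \<Longrightarrow> dist y' y < d0 \<Longrightarrow> dist (u y') (u y) < e / 2"
    using compact_uniformly_continuous[OF u' Y] e unfolding uniformly_continuous_on_def
    by (metis half_gt_zero)
  define d where "d = min d0 D"
  have d: "0 < d" "d \<le> D" "d \<le> d0" using d0 D by (auto simp: d_def)
  define \<theta> where "\<theta> = 1 - d\<^sup>2 / D\<^sup>2"
  have I_eq: "I k = integral (cbox (-a) a) (\<lambda>z. (1 - (norm z)\<^sup>2 / D\<^sup>2) ^ k)" for k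
    by (simp add: I_def)
  note lk = landau_kernel_concentrates[OF a D d(1,2), folded I_eq \<theta>_def]
  have \<theta>0: "0 \<le> \<theta>"
  proof -
    have "d\<^sup>2 \<le> D\<^sup>2" using d by (intro power_mono) auto
    thus ?thesis using D by (simp add: \<theta>_def)
  qed
  have "(\<lambda>k. (\<theta> ^ k / I k) * (2 * M * measure lborel Q)) \<longlonglongrightarrow> 0 * (2 * M * measure lborel Q)"
    by (intro tendsto_mult lk tendsto_const)
  hence "\<forall>\<^sub>F k in sequentially. (\<theta> ^ k / I k) * (2 * M * measure lborel Q) < e / 2"
    using e by (intro order_tendstoD(2)[of _ 0]) auto
  thus ?thesis
  proof eventually_elim
    case (elim k)
    show ?case
    proof
      fix x assume x: "x \<in> X"
      have int1: "(\<lambda>z. q z ^ k *\<^sub>R u (x - z)) integrable_on Q"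
        unfolding Q_def by (intro integrable_continuous continuous_intros cont_q cont_ux)
      have int2: "(\<lambda>z. q z ^ k *\<^sub>R u x) integrable_on Q"
        unfolding Q_def by (intro integrable_continuous continuous_intros cont_q)
      have int3: "(\<lambda>z. q z ^ k) integrable_on Q"
        unfolding Q_def by (intro integrable_continuous cont_q)
      have Ik: "I k = integral Q (\<lambda>z. q z ^ k)" by (simp add: I_def q_def Q_def)
      have "integral Q (\<lambda>z. q z ^ k *\<^sub>R u x) = I k *\<^sub>R u x"
      proof -
        have "((\<lambda>z. q z ^ k *\<^sub>R u x) has_integral I k *\<^sub>R u x) Q"
          unfolding Ik by (intro has_integral_scaleR_left integrable_integral int3)
        thus ?thesis by (rule integral_unique)
      qed
      hence eq: "(1 / I k) *\<^sub>R integral Q (\<lambda>z. q z ^ k *\<^sub>R u (x - z)) - u x =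
        (1 / I k) *\<^sub>R integral Q (\<lambda>z. q z ^ k *\<^sub>R (u (x - z) - u x))"
        using integral_diff[OF int1 int2] lk(1)[of k] by (simp add: scaleR_diff_right)
      \<comment> \<open>The near and far bounds are added instead of splitting the domain, so the
        majorant integrates in closed form.\<close>
      have "norm (integral Q (\<lambda>z. q z ^ k *\<^sub>R (u (x - z) - u x))) \<le>
        integral Q (\<lambda>z. q z ^ k * (e / 2) + 2 * M * \<theta> ^ k)"
      proof (rule integral_norm_bound_integral)
        show "(\<lambda>z. q z ^ k *\<^sub>R (u (x - z) - u x)) integrable_on Q"
          using integrable_diff[OF int1 int2] by (simp add: scaleR_diff_right)
        show "(\<lambda>z. q z ^ k * (e / 2) + 2 * M * \<theta> ^ k) integrable_on Q"
          unfolding Q_def by (intro integrable_continuous continuous_intros cont_q)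
        fix z assume z: "z \<in> Q"
        show "norm (q z ^ k *\<^sub>R (u (x - z) - u x)) \<le> q z ^ k * (e / 2) + 2 * M * \<theta> ^ k"
        proof (cases "norm z < d")
          case True
          hence "norm (u (x - z) - u x) \<le> e / 2"
            using d0(2)[of x "x - z"] XY[OF x] z d(3) by (auto simp: dist_norm intro: less_imp_le)
          hence "q z ^ k * norm (u (x - z) - u x) \<le> q z ^ k * (e / 2)"
            using q01[OF z] by (intro mult_left_mono) auto
          thus ?thesis using M(1) \<theta>0 q01[OF z] by (simp add: add_increasing2)
        next
          case False
          hence "d\<^sup>2 \<le> (norm z)\<^sup>2" using d by (intro power_mono) auto
          hence "q z \<le> \<theta>" using D(1) by (simp add: q_def \<theta>_def field_simps)
          hence 1: "q z ^ k \<le> \<theta> ^ k" using q01[OF z] by (intro power_mono) auto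
          have 2: "norm (u (x - z) - u x) \<le> 2 * M"
            using norm_triangle_ineq4[of "u (x - z)" "u x"] M(2)[OF XY(1)[OF x]] M(2)[OF XY(2)[OF x z]] by simp
          have "q z ^ k * norm (u (x - z) - u x) \<le> \<theta> ^ k * (2 * M)"
            using 1 2 q01[OF z] M(1) \<theta>0 by (intro mult_mono) auto
          moreover have "0 \<le> q z ^ k * (e / 2)" using q01[OF z] e by simp
          ultimately show ?thesis using q01[OF z] by (simp add: mult_ac)
        qed
      qed
      also have "\<dots> = I k * (e / 2) + 2 * M * \<theta> ^ k * measure lborel Q"
      proof -
        have "((\<lambda>z. q z ^ k * (e / 2) + 2 * M * \<theta> ^ k) has_integral I k * (e / 2) + measure lborel Q *\<^sub>R (2 * M * \<theta> ^ k)) Q"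
          unfolding Ik Q_def by (intro has_integral_add has_integral_const has_integral_mult_left integrable_integral int3[unfolded Q_def])
        thus ?thesis by (simp add: integral_unique mult.commute)
      qed
      finally have "norm ((1 / I k) *\<^sub>R integral Q (\<lambda>z. q z ^ k *\<^sub>R (u (x - z) - u x))) \<le>
        (1 / I k) * (I k * (e / 2) + 2 * M * \<theta> ^ k * measure lborel Q)"
        using lk(1)[of k] by (simp add: divide_right_mono)
      also have "\<dots> = e / 2 + (\<theta> ^ k / I k) * (2 * M * measure lborel Q)" using lk(1)[of k] by (simp add: field_simps)
      also have "\<dots> \<le> e" using elim by simp
      finally show "norm ((1 / I k) *\<^sub>R
    integral (cbox (-a) a) (\<lambda>z. (1 - (norm z)\<^sup>2 / D\<^sup>2) ^ k *\<^sub>R u (x - z)) - u x) \<le> e"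
        using eq unfolding Q_def q_def by simp
    qed
  qed
qed

text \<open>One factor \<open>1 - |x - y|\<^sup>2 / D\<^sup>2\<close> is expanded as
  \<open>(1 - c * (x \<bullet> x))\<close> plus the sum of
  \<open>(x \<bullet> i) * (2 * c * (y \<bullet> i))\<close> minus
  \<open>c * (y \<bullet> y)\<close>. The parts in \<open>x\<close> leave the integral and those in
  \<open>y\<close> are absorbed into \<open>g\<close>, hence the induction for all
  \<open>g\<close>.\<close>

lemma landau_convolution_polynomial:
  fixes a b :: "'a::euclidean_space"
  assumes "continuous_on (cbox a b) g"
  shows "real_polynomial_function (\<lambda>x. integral (cbox a b) (\<lambda>y. (1 - (norm (x - y))\<^sup>2 / D\<^sup>2) ^ k * g y))"
  using assms
proof (induction k arbitrary: g)
  case 0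
  show ?case by (simp add: real_polynomial_function.intros(2))
next
  case (Suc k)
  define J where "J g x = integral (cbox a b) (\<lambda>y. (1 - (norm (x - y))\<^sup>2 / D\<^sup>2) ^ k * g y)" for g x
  define c where "c = 1 / D\<^sup>2"
  have intg: "(\<lambda>y. (1 - (norm (x - y))\<^sup>2 / D\<^sup>2) ^ k * g y) integrable_on cbox a b"
    if "continuous_on (cbox a b) g" for g x
    unfolding divide_inverse by (intro integrable_continuous continuous_intros that)
  have eq: "integral (cbox a b) (\<lambda>y. (1 - (norm (x - y))\<^sup>2 / D\<^sup>2) ^ Suc k * g y) =
    (1 - c * (x \<bullet> x)) * J g x + (\<Sum>i\<in>Basis. (x \<bullet> i) * J (\<lambda>y. 2 * c * (y \<bullet> i) * g y) x)
     + J (\<lambda>y. - c * (y \<bullet> y) * g y) x" for x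
  proof -
    have pt: "(1 - (norm (x - y))\<^sup>2 / D\<^sup>2) ^ Suc k * g y =
       (1 - c * (x \<bullet> x)) * ((1 - (norm (x - y))\<^sup>2 / D\<^sup>2) ^ k * g y) +
       (\<Sum>i\<in>Basis. (x \<bullet> i) * ((1 - (norm (x - y))\<^sup>2 / D\<^sup>2) ^ k * (2 * c * (y \<bullet> i) * g y))) +
       (1 - (norm (x - y))\<^sup>2 / D\<^sup>2) ^ k * (- c * (y \<bullet> y) * g y)" for y
    proof -
      have 1: "1 - (norm (x - y))\<^sup>2 / D\<^sup>2 = (1 - c * (x \<bullet> x)) + (\<Sum>i\<in>Basis. (x \<bullet> i) * (2 * c * (y \<bullet> i))) - c * (y \<bullet> y)"
      proof -
        have "(norm (x - y))\<^sup>2 = x \<bullet> x - 2 * (x \<bullet> y) + y \<bullet> y"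
          by (simp add: power2_norm_eq_inner inner_diff inner_commute)
        moreover have "(\<Sum>i\<in>Basis. (x \<bullet> i) * (2 * c * (y \<bullet> i))) = 2 * c * (x \<bullet> y)"
          by (simp add: euclidean_inner[of x y] sum_distrib_left mult_ac)
        moreover have "(norm (x - y))\<^sup>2 / D\<^sup>2 = c * (norm (x - y))\<^sup>2" by (simp add: c_def)
        ultimately show ?thesis by (simp only: ring_distribs)
      qed
      define w where "w = (1 - (norm (x - y))\<^sup>2 / D\<^sup>2) ^ k * g y"
      have "(1 - (norm (x - y))\<^sup>2 / D\<^sup>2) ^ Suc k * g y = (1 - (norm (x - y))\<^sup>2 / D\<^sup>2) * w" by (simp add: w_def)
      also have "\<dots> = ((1 - c * (x \<bullet> x)) + (\<Sum>i\<in>Basis. (x \<bullet> i) * (2 * c * (y \<bullet> i))) - c * (y \<bullet> y)) * w"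
        by (simp only: 1)
      also have "\<dots> = (1 - c * (x \<bullet> x)) * w + (\<Sum>i\<in>Basis. (x \<bullet> i) * (2 * c * (y \<bullet> i) * w)) - c * (y \<bullet> y) * w"
        by (simp only: distrib_right left_diff_distrib sum_distrib_right mult.assoc)
      finally show ?thesis by (simp add: w_def mult_ac)
    qed
    have hJ: "((\<lambda>y. (1 - (norm (x - y))\<^sup>2 / D\<^sup>2) ^ k * g y) has_integral J g x) (cbox a b)"
      if "continuous_on (cbox a b) g" for g
      unfolding J_def by (intro integrable_integral intg that)
    show ?thesis unfolding pt
      by (intro integral_unique has_integral_add has_integral_sum has_integral_mult_right hJ
          continuous_intros Suc.prems) auto
  qed
  have lin: "real_polynomial_function (\<lambda>x::'a. x \<bullet> i)" for i
    by (intro real_polynomial_function.intros(1) bounded_linear_inner_left)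
  have "real_polynomial_function (\<lambda>x::'a. 1 + (- c) * (\<Sum>i\<in>Basis. (x \<bullet> i) * (x \<bullet> i)))"
    by (intro real_polynomial_function.intros(2-4) real_polynomial_function_sum lin) auto
  hence quad: "real_polynomial_function (\<lambda>x::'a. 1 - c * (x \<bullet> x))"
    by (simp add: euclidean_inner[symmetric])
  show ?case unfolding eq
    unfolding J_def
    by (intro real_polynomial_function.intros(3,4) real_polynomial_function_sum Suc.IH continuous_intros
        Suc.prems quad lin) auto
qed

text \<open>The convolution is used in two forms. In \<open>P\<close> the shift falls on
  \<open>G\<close>, so differentiating under the integral gives the same convolution of
  \<open>G'\<close>; in \<open>p\<close> it falls on the kernel, so the result is a polynomial.
  Compact support of \<open>G\<close> makes both agree on a neighbourhood of
  \<open>X\<close>.\<close>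

lemma C1_Weierstrass_compact_support:
  fixes G :: "'a::euclidean_space \<Rightarrow> real"
  assumes G: "\<And>x. (G has_derivative blinfun_apply (G' x)) (at x)" "continuous_on UNIV G'"
    and L: "compact L" "\<And>x. x \<notin> L \<Longrightarrow> G x = 0" and X: "bounded X" and e: "e > 0"
  obtains p where "real_polynomial_function p" "C1_bound X e (\<lambda>x. p x - G x)"
proof -
  \<comment> \<open>\<open>X\<close> is enlarged to an open ball \<open>U\<close> because
    derivatives pass from \<open>P\<close> to \<open>p\<close> only through equality on an open
    set.\<close>
  obtain R where R: "R > 0" "X \<subseteq> ball 0 R" using bounded_subset_ballD[OF X, of 0] by blast
  define U where "U = ball (0::'a) R"
  have U: "open U" "bounded U" "X \<subseteq> U" using R by (auto simp: U_def)
  have "compact {x - y |x y. x \<in> closure U \<and> y \<in> L}"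
    using U L by (intro compact_differences) auto
  hence "bounded (cball 0 1 \<union> L \<union> {x - y |x y. x \<in> closure U \<and> y \<in> L})"
    using L(1) by (auto simp: compact_imp_bounded)
  \<comment> \<open>The unit ball forces all coordinates of \<open>a\<close> to be positive. The
    other two sets ensure that the substitution \<open>z = x - y\<close> loses no point where the
    integrand is nonzero.\<close>
  then obtain a where a: "cball 0 1 \<union> L \<union> {x - y |x y. x \<in> closure U \<and> y \<in> L} \<subseteq> cbox (-a) a"
    using bounded_subset_cbox_symmetric by blast
  have a_pos: "a \<bullet> b > 0" if b: "b \<in> Basis" for b
  proof -
    have "b \<in> cbox (-a) a" using a b by (auto simp: subset_iff)
    hence "b \<bullet> b \<le> a \<bullet> b" using b by (auto simp: mem_box)
    thus ?thesis using b by (simp add: inner_Basis)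
  qed
  have L_sub: "L \<subseteq> cbox (-a) a" using a by blast
  have UL: "x - y \<in> cbox (-a) a" if "x \<in> U" "y \<in> L" for x y
    using a that closure_subset[of U] by blast
  obtain D where D: "D > 0" "\<And>z. z \<in> cbox (-a) a \<Longrightarrow> norm z \<le> D"
    using bounded_cbox[of "-a" a] by (auto simp: bounded_pos)
  have cont_G: "continuous_on A G" for A
    using G(1) has_derivative_continuous continuous_at_imp_continuous_on by blast
  define I where "I k = integral (cbox (-a) a) (\<lambda>z. (1 - (norm z)\<^sup>2 / D\<^sup>2) ^ k)" for k
  define P where "P k x = (1 / I k) *\<^sub>R integral (cbox (-a) a) (\<lambda>z. (1 - (norm z)\<^sup>2 / D\<^sup>2) ^ k *\<^sub>R G (x - z))" for k x
  define P' where "P' k x = (1 / I k) *\<^sub>R integral (cbox (-a) a) (\<lambda>z. (1 - (norm z)\<^sup>2 / D\<^sup>2) ^ k *\<^sub>R G' (x - z))" for k x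
  define p where "p k x = (1 / I k) * integral (cbox (-a) a) (\<lambda>y. (1 - (norm (x - y))\<^sup>2 / D\<^sup>2) ^ k * G y)" for k x
  have poly: "real_polynomial_function (p k)" for k
    unfolding p_def
    by (intro real_polynomial_function.intros(4) real_polynomial_function.intros(2)
        landau_convolution_polynomial cont_G)
  have P_der: "(P k has_derivative blinfun_apply (P' k x)) (at x)" for k x
  proof -
    have cq: "continuous_on A (\<lambda>z. (1 - (norm z)\<^sup>2 / D\<^sup>2) ^ k)" for A :: "'a set"
      using D(1) by (intro continuous_intros) auto
    have "((\<lambda>x. integral (cbox (-a) a) (\<lambda>z. (1 - (norm z)\<^sup>2 / D\<^sup>2) ^ k *\<^sub>R G (x - z))) has_derivative
       blinfun_apply (integral (cbox (-a) a) (\<lambda>z. (1 - (norm z)\<^sup>2 / D\<^sup>2) ^ k *\<^sub>R G' (x - z)))) (at x within UNIV)"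
    proof (rule leibniz_rule)
      show "((\<lambda>x. (1 - (norm z)\<^sup>2 / D\<^sup>2) ^ k *\<^sub>R G (x - z)) has_derivative
         blinfun_apply ((1 - (norm z)\<^sup>2 / D\<^sup>2) ^ k *\<^sub>R G' (x - z))) (at x within UNIV)" for x z
      proof -
        have "((\<lambda>x. x - z) has_derivative (\<lambda>v. v)) (at x)" by (auto intro!: derivative_eq_intros)
        from has_derivative_compose[OF this G(1)]
        have "((\<lambda>x. G (x - z)) has_derivative blinfun_apply (G' (x - z))) (at x)" by simp
        from has_derivative_scaleR_right[OF this] show ?thesis by (simp add: scaleR_blinfun.rep_eq)
      qed
      show "(\<lambda>z. (1 - (norm z)\<^sup>2 / D\<^sup>2) ^ k *\<^sub>R G (x - z)) integrable_on cbox (-a) a" for x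
        by (intro integrable_continuous continuous_on_scaleR cq continuous_on_compose2[OF cont_G[of UNIV]] continuous_intros) auto
      show "continuous_on (UNIV \<times> cbox (-a) a) (\<lambda>(x, z). (1 - (norm z)\<^sup>2 / D\<^sup>2) ^ k *\<^sub>R G' (x - z))"
        unfolding case_prod_beta
        by (intro continuous_on_scaleR continuous_on_compose2[OF cq[of UNIV]] continuous_on_compose2[OF G(2)] continuous_intros) auto
    qed auto
    from has_derivative_scaleR_right[OF this, of "1 / I k"]
    show ?thesis unfolding P_def[abs_def] P'_def by (simp add: scaleR_blinfun.rep_eq)
  qed
  have p_eq: "p k x = P k x" if x: "x \<in> U" for k x
  proof -
    define f where "f y = (1 - (norm (x - y))\<^sup>2 / D\<^sup>2) ^ k * G y" for y
    have f0: "f y = 0" if "y \<notin> L" for y using L(2)[OF that] by (simp add: f_def)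
    have cont_f: "continuous_on A f" for A
      unfolding f_def using D(1) by (intro continuous_intros cont_G) auto
    have "(f has_integral integral (cbox (-a) a) f) (cbox (-a) a)"
      by (intro integrable_integral integrable_continuous cont_f)
    from has_integral_affinity[OF this, of "-1" x]
    have 1: "((\<lambda>z. f (x - z)) has_integral integral (cbox (-a) a) f) ((\<lambda>y. x - y) ` cbox (-a) a)"
      by (simp add: algebra_simps)
    \<comment> \<open>The substitution yields the integral over the reflected and shifted box. Both
      set differences with the original box avoid the support of the integrand.\<close>
    have "((\<lambda>z. f (x - z)) has_integral integral (cbox (-a) a) f) (cbox (-a) a)"
    proof (rule has_integral_spike_set_eq[THEN iffD1, OF _ _ 1])
      have z1: "z \<in> (\<lambda>y. x - y) ` cbox (-a) a \<and> z \<in> cbox (-a) a" if "f (x - z) \<noteq> 0" for z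
      proof -
        have "x - z \<in> L" using f0 that by blast
        hence "x - z \<in> cbox (-a) a" "x - (x - z) \<in> cbox (-a) a" using L_sub UL[OF x] by blast+
        moreover have "z = x - (x - z)" by simp
        ultimately show ?thesis by (metis diff_diff_eq2 add_diff_cancel_left' imageI)
      qed
      show "negligible {z \<in> (\<lambda>y. x - y) ` cbox (-a) a - cbox (-a) a. f (x - z) \<noteq> 0}"
        using z1 by (intro negligible_subset[OF negligible_empty]) blast
      show "negligible {z \<in> cbox (-a) a - (\<lambda>y. x - y) ` cbox (-a) a. f (x - z) \<noteq> 0}"
        using z1 by (intro negligible_subset[OF negligible_empty]) blast
    qed
    hence "integral (cbox (-a) a) (\<lambda>z. f (x - z)) = integral (cbox (-a) a) f" by (rule integral_unique)
    thus ?thesis unfolding p_def P_def f_def by simp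
  qed
  have "\<forall>\<^sub>F k in sequentially. (\<forall>x\<in>U. norm (P k x - G x) \<le> e) \<and> (\<forall>x\<in>U. norm (P' k x - G' x) \<le> e)"
    unfolding P_def P'_def I_def
    by (intro eventually_conj landau_kernel_approximate_identity a_pos D cont_G G U e)
  then obtain k where k: "\<And>x. x \<in> U \<Longrightarrow> norm (P k x - G x) \<le> e" "\<And>x. x \<in> U \<Longrightarrow> norm (P' k x - G' x) \<le> e"
    by (auto simp: eventually_sequentially)
  have "C1_bound U e (\<lambda>x. p k x - G x)"
  proof (rule C1_boundI)
    fix x assume x: "x \<in> U"
    show "norm (p k x - G x) \<le> e" using k(1)[OF x] p_eq[OF x] by simp
    have "(p k has_derivative blinfun_apply (P' k x)) (at x)"
      by (rule has_derivative_transform_within_open[OF P_der U(1) x]) (use p_eq in auto)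
    from has_derivative_diff[OF this G(1)]
    show "((\<lambda>x. p k x - G x) has_derivative blinfun_apply (P' k x - G' x)) (at x)"
      by (simp add: minus_blinfun.rep_eq)
    show "norm (blinfun_apply (P' k x - G' x) v) \<le> e * norm v" for v
      using norm_blinfun[of "P' k x - G' x" v] mult_right_mono[OF k(2)[OF x] norm_ge_zero[of v]] by linarith
  qed
  with poly[of k] U(3) show ?thesis using that C1_bound_subset by blast
qed

text \<open>The extension agrees with \<open>g\<close> on an open set around \<open>K\<close>, not
  merely on \<open>K\<close>; this is what carries the derivative bound over.\<close>

lemma C1_Weierstrass:
  fixes g :: "'a::euclidean_space \<Rightarrow> real"
  assumes K: "compact K" and S: "open S" "K \<subseteq> S"
    and g: "\<And>x. x \<in> S \<Longrightarrow> (g has_derivative blinfun_apply (g' x)) (at x)" "continuous_on S g'"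
  shows "g \<in> C1_closure K (Collect real_polynomial_function)"
proof (rule C1_closureI)
  fix e :: real assume e: "e > 0"
  obtain G G' V L where *: "open V" "K \<subseteq> V" "compact L"
    "\<And>x. (G has_derivative blinfun_apply (G' x)) (at x)" "continuous_on UNIV G'"
    "\<And>x. x \<in> V \<Longrightarrow> G x = g x" "\<And>x. x \<notin> L \<Longrightarrow> G x = 0"
    by (rule C1_compact_support_extension[OF K S g]) (assumption | rule that)+
  obtain p where p: "real_polynomial_function p" "C1_bound K e (\<lambda>x. p x - G x)"
    by (rule C1_Weierstrass_compact_support[OF *(4,5,3,7) compact_imp_bounded[OF K] e]) (assumption | rule that)+
  have "C1_bound K e (\<lambda>x. p x - g x)" unfolding C1_bound_def
  proof (intro ballI conjI)
    fix x assume x: "x \<in> K"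
    with p(2) obtain D where D: "norm (p x - G x) \<le> e" "((\<lambda>x. p x - G x) has_derivative D) (at x)"
      "\<forall>v. norm (D v) \<le> e * norm v" unfolding C1_bound_def by blast
    have xV: "x \<in> V" using x *(2) by blast
    show "norm (p x - g x) \<le> e" using D(1) *(6)[OF xV] by simp
    have "((\<lambda>x. p x - g x) has_derivative D) (at x)"
      by (rule has_derivative_transform_within_open[OF D(2) *(1) xV]) (use *(6) in auto)
    with D(3) show "\<exists>D. ((\<lambda>x. p x - g x) has_derivative D) (at x) \<and> (\<forall>v. norm (D v) \<le> e * norm v)" by blast
  qed
  with p(1) show "\<exists>p\<in>Collect real_polynomial_function. C1_bound K e (\<lambda>x. p x - g x)" by blast
qed

subsection \<open>Exponential sums with frequencies in a small ball\<close>

lemma has_derivative_cis_inner: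
  "((\<lambda>x. cis (x \<bullet> y)) has_derivative (\<lambda>v. (\<i> * complex_of_real (v \<bullet> y)) * cis (x \<bullet> y))) (at x)"
  by (auto intro!: derivative_eq_intros simp: scaleR_conv_of_real)

lemma C1_bound_cis_inner: "C1_bound B (1 + norm y) (\<lambda>x. cis (x \<bullet> y))"
proof (rule C1_boundI)
  show "((\<lambda>x. cis (x \<bullet> y)) has_derivative (\<lambda>v. (\<i> * complex_of_real (v \<bullet> y)) * cis (x \<bullet> y))) (at x)" for x
    by (rule has_derivative_cis_inner)
  show "norm ((\<i> * complex_of_real (v \<bullet> y)) * cis (x \<bullet> y)) \<le> (1 + norm y) * norm v" for x v
    using Cauchy_Schwarz_ineq2[of v y] by (simp add: norm_mult algebra_simps add_increasing)
qed auto

lemma C1_bound_of_real: "C1_bound B M f \<Longrightarrow> C1_bound B M (\<lambda>x. complex_of_real (f x))"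
  using C1_bound_linear[where K=1 and T=complex_of_real, OF bounded_linear_of_real] by fastforce

text \<open>Finite exponential sums with complex coefficients. The sign in the exponent is that of
  the kernel in \<open>Frho\<close>.\<close>

inductive_set trig :: "'a::euclidean_space set \<Rightarrow> ('a \<Rightarrow> complex) set" for \<Omega> where
  zero: "(\<lambda>x. 0) \<in> trig \<Omega>"
| add_cis: "f \<in> trig \<Omega> \<Longrightarrow> \<xi> \<in> \<Omega> \<Longrightarrow> (\<lambda>x. f x + a * cis (- (x \<bullet> \<xi>))) \<in> trig \<Omega>"

lemma trig_cis: "\<xi> \<in> \<Omega> \<Longrightarrow> (\<lambda>x. a * cis (- (x \<bullet> \<xi>))) \<in> trig \<Omega>"
  using trig.add_cis[OF trig.zero, of \<xi> \<Omega> a] by simp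

lemma trig_add:
  assumes "f \<in> trig \<Omega>" "g \<in> trig \<Omega>"
  shows "(\<lambda>x. f x + g x) \<in> trig \<Omega>"
  using assms(2)
proof induction
  case (add_cis g \<xi> a)
  from trig.add_cis[OF this(3,2), of a] show ?case by (simp add: add.assoc)
qed (use assms(1) in simp)

lemma trig_mult_cis:
  assumes "f \<in> trig \<Omega>" "\<And>\<xi>. \<xi> \<in> \<Omega> \<Longrightarrow> \<xi> + \<eta> \<in> \<Omega>'"
  shows "(\<lambda>x. f x * (c * cis (- (x \<bullet> \<eta>)))) \<in> trig \<Omega>'"
  using assms(1)
proof induction
  case (add_cis f \<xi> a)
  have "(\<lambda>x. f x * (c * cis (- (x \<bullet> \<eta>))) + (a * c) * cis (- (x \<bullet> (\<xi> + \<eta>)))) \<in> trig \<Omega>'"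
    by (intro trig.add_cis add_cis assms(2))
  also have "(\<lambda>x. f x * (c * cis (- (x \<bullet> \<eta>))) + (a * c) * cis (- (x \<bullet> (\<xi> + \<eta>)))) =
     (\<lambda>x. (f x + a * cis (- (x \<bullet> \<xi>))) * (c * cis (- (x \<bullet> \<eta>))))"
    by (auto simp: inner_add_right cis_mult[symmetric] algebra_simps minus_add_distrib simp del: minus_add_distrib
        intro!: ext) (simp add: cis_mult add.commute)
  finally show ?case .
qed (simp add: trig.zero)

text \<open>Frequencies add under multiplication. The two uses are halving the radius around
  \<open>0\<close> and translating to \<open>y\<close> with the frequency set
  \<open>{y}\<close>.\<close>

lemma trig_mult:
  assumes f: "f \<in> trig \<Omega>" and g: "g \<in> trig \<Omega>'"
    and sum: "\<And>\<xi> \<eta>. \<xi> \<in> \<Omega> \<Longrightarrow> \<eta> \<in> \<Omega>' \<Longrightarrow> \<xi> + \<eta> \<in> \<Omega>''"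
  shows "(\<lambda>x. f x * g x) \<in> trig \<Omega>''"
  using g
proof induction
  case (add_cis g \<eta> a)
  have "(\<lambda>x. f x * g x + f x * (a * cis (- (x \<bullet> \<eta>)))) \<in> trig \<Omega>''"
    by (intro trig_add add_cis trig_mult_cis[OF f] sum)
  thus ?case by (simp add: distrib_left)
qed (simp add: trig.zero)

lemma C1_closure_trig_mult_const:
  assumes "f \<in> C1_closure B (trig \<Omega>)"
  shows "(\<lambda>x. c * f x) \<in> C1_closure B (trig \<Omega>)"
proof (rule C1_closure_linear[OF bounded_linear_mult_right assms])
  fix u assume "u \<in> trig \<Omega>"
  \<comment> \<open>A constant factor is an exponential of frequency \<open>0\<close>.\<close>
  from trig_mult_cis[OF this, of 0 \<Omega> c] show "(\<lambda>x. c * u x) \<in> trig \<Omega>" by (simp add: mult.commute)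
qed

text \<open>Imaginary and real part of one Taylor estimate: \<open>e^(i t) - 1 - i t\<close> has
  modulus at most \<open>t\<^sup>2 / 2\<close>.\<close>

lemma sin_cos_linear_approx:
  fixes t :: real
  shows "\<bar>sin t - t\<bar> \<le> t\<^sup>2 / 2" "\<bar>cos t - 1\<bar> \<le> t\<^sup>2 / 2"
proof -
  have "cmod (iexp t - (\<Sum>k\<le>1. (\<i> * t) ^ k / fact k)) \<le> t\<^sup>2 / 2"
    using iexp_approx1[of t 1] by (simp add: power2_eq_square)
  moreover have "(\<Sum>k\<le>1. (\<i> * t) ^ k / fact k) = 1 + \<i> * t" by (simp add: numeral_eq_Suc)
  ultimately have *: "cmod (cis t - (1 + \<i> * t)) \<le> t\<^sup>2 / 2" by (simp add: cis_conv_exp)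
  show "\<bar>sin t - t\<bar> \<le> t\<^sup>2 / 2" using abs_Im_le_cmod[of "cis t - (1 + \<i> * t)"] * by simp
  show "\<bar>cos t - 1\<bar> \<le> t\<^sup>2 / 2" using abs_Re_le_cmod[of "cis t - (1 + \<i> * t)"] * by simp
qed

lemma inner_in_C1_closure_trig:
  fixes w :: "'a::euclidean_space"
  assumes B: "bounded B" and r: "r > 0"
  shows "(\<lambda>x. complex_of_real (x \<bullet> w)) \<in> C1_closure B (trig (ball 0 r))"
proof (rule C1_closureI)
  fix e :: real assume e: "e > 0"
  obtain R where R: "R > 0" "\<And>x. x \<in> B \<Longrightarrow> norm x \<le> R" using B by (auto simp: bounded_pos)
  define N where "N = R * norm w"
  \<comment> \<open>The first entry keeps the frequencies inside \<open>ball 0 r\<close>. The bound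
    1 turns \<open>d * d\<close> into \<open>d\<close> in the derivative error, and the last entry
    makes \<open>d * N\<^sup>2\<close> and \<open>d * N\<^sup>2 * norm w\<close> at most
    \<open>e\<close>. The added ones keep the denominators positive.\<close>
  define d where "d = min (r / (2 * (norm w + 1))) (min 1 (e / ((N\<^sup>2 + 1) * (norm w + 1))))"
  have pos: "norm w + 1 > 0" "N\<^sup>2 + 1 > 0" by (auto intro: add_nonneg_pos)
  have d: "d > 0" "d \<le> 1" using r e pos by (auto simp: d_def)
  have dr: "d * norm w < r"
  proof -
    have "d * (norm w + 1) \<le> r / (2 * (norm w + 1)) * (norm w + 1)"
      using pos by (intro mult_right_mono) (auto simp: d_def)
    also have "\<dots> = r / 2" using pos by (simp add: field_simps)
    finally have "d * (norm w + 1) < r" using r by simp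
    thus ?thesis using d(1) by (simp add: algebra_simps)
  qed
  have de: "d * ((N\<^sup>2 + 1) * (norm w + 1)) \<le> e"
  proof -
    have "d * ((N\<^sup>2 + 1) * (norm w + 1)) \<le> e / ((N\<^sup>2 + 1) * (norm w + 1)) * ((N\<^sup>2 + 1) * (norm w + 1))"
      using pos by (intro mult_right_mono) (auto simp: d_def)
    thus ?thesis using pos by simp
  qed
  have "d * N\<^sup>2 * 1 \<le> d * (N\<^sup>2 + 1) * (norm w + 1)" "d * N\<^sup>2 * norm w \<le> d * (N\<^sup>2 + 1) * (norm w + 1)"
    using d(1) by (intro mult_mono; simp)+
  hence de': "d * N\<^sup>2 \<le> e" "d * N\<^sup>2 * norm w \<le> e" using de by (auto simp: mult.assoc)
  have xw: "(x \<bullet> w)\<^sup>2 \<le> N\<^sup>2" if "x \<in> B" for x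
  proof -
    have "\<bar>x \<bullet> w\<bar> \<le> N" unfolding N_def
      using Cauchy_Schwarz_ineq2[of x w] mult_right_mono[OF R(2)[OF that] norm_ge_zero[of w]] by linarith
    thus ?thesis using abs_le_square_iff[of "x \<bullet> w" N] by (smt (verit) abs_ge_self)
  qed
  \<comment> \<open>Its two frequencies \<open>\<plusminus>d w\<close> are small, and it tends to the linear function as \<open>d \<rightarrow> 0\<close>.\<close>
  define f where "f x = sin (d * (x \<bullet> w)) / d" for x
  have "(\<lambda>x. (- \<i> / complex_of_real (2 * d)) * cis (- (x \<bullet> (- d *\<^sub>R w))) + (\<i> / complex_of_real (2 * d)) * cis (- (x \<bullet> (d *\<^sub>R w)))) \<in> trig (ball 0 r)"
    using d dr by (intro trig_add trig_cis) (auto simp: dist_norm)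
  also have "(\<lambda>x. (- \<i> / complex_of_real (2 * d)) * cis (- (x \<bullet> (- d *\<^sub>R w))) + (\<i> / complex_of_real (2 * d)) * cis (- (x \<bullet> (d *\<^sub>R w)))) = (\<lambda>x. complex_of_real (f x))"
    using d by (auto simp: f_def fun_eq_iff complex_eq_iff field_simps)
  finally have f: "(\<lambda>x. complex_of_real (f x)) \<in> trig (ball 0 r)" .
  have "C1_bound B e (\<lambda>x. f x - x \<bullet> w)"
  proof (rule C1_boundI)
    fix x assume x: "x \<in> B"
    have "\<bar>sin (d * (x \<bullet> w)) - d * (x \<bullet> w)\<bar> \<le> (d * (x \<bullet> w))\<^sup>2 / 2" by (rule sin_cos_linear_approx)
    hence "\<bar>sin (d * (x \<bullet> w)) - d * (x \<bullet> w)\<bar> / d \<le> (d * (x \<bullet> w))\<^sup>2 / 2 / d" using d by (intro divide_right_mono) auto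
    also have "\<dots> = d * (x \<bullet> w)\<^sup>2 / 2" using d by (simp add: power2_eq_square)
    also have "\<dots> \<le> d * N\<^sup>2 / 2" using xw[OF x] d by simp
    also have "\<dots> \<le> e" using de'(1) d(1) e by simp
    also have "\<bar>sin (d * (x \<bullet> w)) - d * (x \<bullet> w)\<bar> / d = \<bar>f x - x \<bullet> w\<bar>"
    proof -
      have "f x - x \<bullet> w = (sin (d * (x \<bullet> w)) - d * (x \<bullet> w)) / d" using d by (simp add: f_def field_simps)
      thus ?thesis using d by (simp add: abs_divide)
    qed
    finally show "norm (f x - x \<bullet> w) \<le> e" by simp
    show "((\<lambda>x. f x - x \<bullet> w) has_derivative (\<lambda>v. (cos (d * (x \<bullet> w)) - 1) * (v \<bullet> w))) (at x)"
      unfolding f_def using d by (auto intro!: derivative_eq_intros simp: field_simps)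
    fix v
    have "\<bar>cos (d * (x \<bullet> w)) - 1\<bar> \<le> (d * (x \<bullet> w))\<^sup>2 / 2" by (rule sin_cos_linear_approx)
    also have "\<dots> = (d * d) * (x \<bullet> w)\<^sup>2 / 2" by (simp add: power2_eq_square)
    also have "\<dots> \<le> (d * 1) * N\<^sup>2" using d xw[OF x]
      by (intro order_trans[OF _ mult_mono[of "d * d" "d * 1" "(x \<bullet> w)\<^sup>2" "N\<^sup>2"]]) (auto intro: mult_left_mono)
    finally have "\<bar>cos (d * (x \<bullet> w)) - 1\<bar> * \<bar>v \<bullet> w\<bar> \<le> (d * N\<^sup>2) * (norm v * norm w)"
      using Cauchy_Schwarz_ineq2[of v w] d by (intro mult_mono) auto
    also have "\<dots> = (d * N\<^sup>2 * norm w) * norm v" by simp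
    also have "\<dots> \<le> e * norm v" using de'(2) by (rule mult_right_mono) simp
    finally show "norm ((cos (d * (x \<bullet> w)) - 1) * (v \<bullet> w)) \<le> e * norm v" by (simp add: abs_mult)
  qed
  from C1_bound_of_real[OF this]
  have "C1_bound B e (\<lambda>x. complex_of_real (f x) - complex_of_real (x \<bullet> w))" by simp
  with f show "\<exists>g\<in>trig (ball 0 r). C1_bound B e (\<lambda>x. g x - complex_of_real (x \<bullet> w))"
    by (intro bexI[of _ "\<lambda>x. complex_of_real (f x)"])
qed

text \<open>Riesz representation in finite dimension: \<open>w\<close> is the adjoint of
  \<open>f\<close> applied to 1.\<close>

lemma bounded_linear_functional_inner:
  fixes f :: "'a::euclidean_space \<Rightarrow> real"
  assumes "bounded_linear f"
  obtains w where "\<And>x. f x = x \<bullet> w"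
  using adjoint_works[OF bounded_linear.linear[OF assms], of _ 1] by (metis inner_real_def mult.right_neutral)

text \<open>Supplies the bounds on the factors that \<open>C1_closure_mult\<close> asks for.\<close>

lemma C1_bound_real_polynomial:
  fixes p :: "'a::euclidean_space \<Rightarrow> real"
  assumes "real_polynomial_function p" and B: "bounded B"
  shows "\<exists>M\<ge>0. C1_bound B M p"
  using assms(1)
proof induction
  case (linear f)
  obtain w where w: "\<And>x. f x = x \<bullet> w" using bounded_linear_functional_inner[OF linear] by blast
  obtain R where R: "R > 0" "\<And>x. x \<in> B \<Longrightarrow> norm x \<le> R" using B by (auto simp: bounded_pos)
  have "C1_bound B ((R + 1) * norm w) f"
  proof (rule C1_boundI)
    show "(f has_derivative f) (at x)" for x by (rule bounded_linear_imp_has_derivative[OF linear])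
    show "norm (f v) \<le> (R + 1) * norm w * norm v" for v
    proof -
      have "norm (f v) \<le> 1 * (norm w * norm v)" using Cauchy_Schwarz_ineq2[of v w] by (simp add: w mult.commute)
      also have "\<dots> \<le> (R + 1) * (norm w * norm v)" using R by (intro mult_right_mono) auto
      finally show ?thesis by (simp add: mult.assoc)
    qed
    show "norm (f x) \<le> (R + 1) * norm w" if "x \<in> B" for x
    proof -
      have "norm (f x) \<le> norm x * norm w" using Cauchy_Schwarz_ineq2[of x w] by (simp add: w)
      also have "\<dots> \<le> (R + 1) * norm w" using R(2)[OF that] by (intro mult_right_mono) auto
      finally show ?thesis .
    qed
  qed
  thus ?case using R by (intro exI[of _ "(R + 1) * norm w"]) auto
next
  case (const c)
  have "C1_bound B \<bar>c\<bar> (\<lambda>x. c)" by (rule C1_boundI[where D="\<lambda>x v. 0"]) auto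
  thus ?case by (intro exI[of _ "\<bar>c\<bar>"]) auto
next
  case (add f g)
  then obtain M N where "M \<ge> 0" "N \<ge> 0" "C1_bound B M f" "C1_bound B N g" by blast
  thus ?case by (intro exI[of _ "M + N"]) (auto intro: C1_bound_add)
next
  case (mult f g)
  then obtain M N where "M \<ge> 0" "N \<ge> 0" "C1_bound B M f" "C1_bound B N g" by blast
  thus ?case by (intro exI[of _ "2 * M * N"]) (auto intro: C1_bound_mult)
qed

text \<open>The radius is generalized in the induction: in a product both factors are approximated
  with radius \<open>r / 2\<close>, so that the summed frequencies stay in
  \<open>ball 0 r\<close>.\<close>

lemma real_polynomial_in_C1_closure_trig:
  fixes p :: "'a::euclidean_space \<Rightarrow> real"
  assumes "real_polynomial_function p" and B: "bounded B" and "r > 0"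
  shows "(\<lambda>x. complex_of_real (p x)) \<in> C1_closure B (trig (ball 0 r))"
  using assms(1) \<open>r > 0\<close>
proof (induction arbitrary: r)
  case (linear f)
  obtain w where w: "\<And>x. f x = x \<bullet> w" using bounded_linear_functional_inner[OF linear(1)] by blast
  show ?case unfolding w by (rule inner_in_C1_closure_trig[OF B linear(2)])
next
  case (const c)
  have "(\<lambda>x. complex_of_real c * cis (- (x \<bullet> 0))) \<in> trig (ball (0::'a) r)" using const by (intro trig_cis) auto
  thus ?case using subset_C1_closure by fastforce
next
  case (add f g)
  thus ?case by (auto intro!: C1_closure_add trig_add)
next
  case (mult f g)
  obtain M where M: "C1_bound B M f" using C1_bound_real_polynomial[OF mult(1) B] by blast
  obtain N where N: "C1_bound B N g" using C1_bound_real_polynomial[OF mult(2) B] by blast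
  have half: "\<xi> + \<eta> \<in> ball 0 r" if "\<xi> \<in> ball 0 (r/2)" "\<eta> \<in> ball 0 (r/2)" for \<xi> \<eta> :: 'a
    using that norm_triangle_ineq[of \<xi> \<eta>] by simp
  have "(\<lambda>x. complex_of_real (f x) * complex_of_real (g x)) \<in> C1_closure B (trig (ball 0 r))"
    by (rule C1_closure_mult[OF mult(3)[of "r/2"] C1_bound_of_real[OF M] mult(4)[of "r/2"] C1_bound_of_real[OF N]
          trig_mult[OF _ _ half]])
      (use mult in auto)
  thus ?case by simp
qed

context
  fixes B S :: "'a::euclidean_space set"
  assumes B: "bounded B" and S: "open S" "closure B \<subseteq> S"
begin

text \<open>The bound on \<open>g\<close> is a by-product of the approximation: a polynomial at
  distance at most 1 is itself bounded on \<open>B\<close>.\<close>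

lemma C1_in_closure_trig_at_0:
  fixes g :: "'a \<Rightarrow> real"
  assumes g: "\<And>x. x \<in> S \<Longrightarrow> (g has_derivative blinfun_apply (g' x)) (at x)" "continuous_on S g'"
  shows "\<exists>M. C1_bound B M g"
    and "r > 0 \<Longrightarrow> (\<lambda>x. complex_of_real (g x)) \<in> C1_closure B (trig (ball 0 r))"
proof -
  have "compact (closure B)" using B by (simp add: compact_closure)
  from C1_closure_subset[OF C1_Weierstrass[OF this S g] closure_subset]
  have *: "g \<in> C1_closure B (Collect real_polynomial_function)" by simp
  obtain p where p: "real_polynomial_function p" "C1_bound B 1 (\<lambda>x. p x - g x)"
    using C1_closureE[OF *, of 1] by auto
  obtain M where M: "C1_bound B M p" using C1_bound_real_polynomial[OF p(1) B] by blast
  have "C1_bound B (1 * 1) (\<lambda>x. - (p x - g x))"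
    using p(2) by (intro C1_bound_linear bounded_linear_minus bounded_linear_ident) auto
  from C1_bound_add[OF M this] show "\<exists>M. C1_bound B M g" by auto
  show "(\<lambda>x. complex_of_real (g x)) \<in> C1_closure B (trig (ball 0 r))" if "r > 0"
  proof (rule C1_closure_idem)
    show "(\<lambda>x. complex_of_real (g x)) \<in> C1_closure B {\<lambda>x. complex_of_real (p x) |p. real_polynomial_function p}"
      by (rule C1_closure_linear[OF bounded_linear_of_real *]) auto
  qed (use real_polynomial_in_C1_closure_trig[OF _ B that] in auto)
qed

text \<open>Frequencies around \<open>0\<close> are moved to frequencies around \<open>y\<close> by writing \<open>g = (g cis (x \<bullet> y)) cis (- (x \<bullet> y))\<close>.\<close>

lemma C1_in_closure_trig:
  fixes g :: "'a \<Rightarrow> real"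
  assumes g: "\<And>x. x \<in> S \<Longrightarrow> (g has_derivative blinfun_apply (g' x)) (at x)" "continuous_on S g'"
    and r: "r > 0"
  shows "(\<lambda>x. complex_of_real (g x)) \<in> C1_closure B (trig (ball y r))"
proof -
  have half: "\<xi> + \<eta> \<in> ball 0 r" if "\<xi> \<in> ball 0 (r/2)" "\<eta> \<in> ball 0 (r/2)" for \<xi> \<eta> :: 'a
    using that norm_triangle_ineq[of \<xi> \<eta>] by simp
  \<comment> \<open>Although \<open>y\<close> may be far from \<open>0\<close>,
    \<open>cos (x \<bullet> y)\<close> and \<open>sin (x \<bullet> y)\<close> are real smooth
    functions, so on the bounded set \<open>B\<close> they too are limits of sums with small
    frequencies.\<close>
  have cos: "(\<lambda>x. complex_of_real (cos (x \<bullet> y))) \<in> C1_closure B (trig (ball 0 (r/2)))"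
  proof (rule C1_in_closure_trig_at_0(2)[where g'="\<lambda>x. (- sin (x \<bullet> y)) *\<^sub>R blinfun_inner_left y"])
    show "((\<lambda>x. cos (x \<bullet> y)) has_derivative blinfun_apply (- sin (x \<bullet> y) *\<^sub>R blinfun_inner_left y)) (at x)" for x
      by (auto intro!: derivative_eq_intros simp: scaleR_blinfun.rep_eq uminus_blinfun.rep_eq)
  qed (use r in \<open>auto intro!: continuous_intros\<close>)
  have sin: "(\<lambda>x. complex_of_real (sin (x \<bullet> y))) \<in> C1_closure B (trig (ball 0 (r/2)))"
  proof (rule C1_in_closure_trig_at_0(2)[where g'="\<lambda>x. cos (x \<bullet> y) *\<^sub>R blinfun_inner_left y"])
    show "((\<lambda>x. sin (x \<bullet> y)) has_derivative blinfun_apply (cos (x \<bullet> y) *\<^sub>R blinfun_inner_left y)) (at x)" for x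
      by (auto intro!: derivative_eq_intros simp: scaleR_blinfun.rep_eq)
  qed (use r in \<open>auto intro!: continuous_intros\<close>)
  have "(\<lambda>x. complex_of_real (cos (x \<bullet> y)) + \<i> * complex_of_real (sin (x \<bullet> y))) \<in> C1_closure B (trig (ball 0 (r/2)))"
    by (rule C1_closure_add[OF cos C1_closure_trig_mult_const[OF sin] trig_add])
  hence cis: "(\<lambda>x. cis (x \<bullet> y)) \<in> C1_closure B (trig (ball 0 (r/2)))"
    by (simp add: cis.ctr Complex_eq)
  obtain M where M: "C1_bound B M g" using C1_in_closure_trig_at_0(1)[OF g] by blast
  have gcis: "(\<lambda>x. complex_of_real (g x) * cis (x \<bullet> y)) \<in> C1_closure B (trig (ball 0 r))"
    by (rule C1_closure_mult[OF C1_in_closure_trig_at_0(2)[OF g, of "r/2"] C1_bound_of_real[OF M] cis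
        C1_bound_cis_inner trig_mult[OF _ _ half]]) (use r in auto)
  obtain M' where M': "C1_bound B M' (\<lambda>x. complex_of_real (g x) * cis (x \<bullet> y))"
  proof -
    have "C1_bound B (2 * max M 0 * (1 + norm y)) (\<lambda>x. complex_of_real (g x) * cis (x \<bullet> y))"
      by (intro C1_bound_mult C1_bound_of_real C1_bound_mono[OF M] C1_bound_cis_inner) auto
    thus ?thesis using that by blast
  qed
  \<comment> \<open>The last factor is used exactly, with the single frequency \<open>y\<close>, so
    the ball is translated without being enlarged.\<close>
  have "(\<lambda>x. 1 * cis (- (x \<bullet> y))) \<in> C1_closure B (trig {y})"
    by (intro subset_C1_closure trig_cis) auto
  hence "(\<lambda>x. (complex_of_real (g x) * cis (x \<bullet> y)) * (1 * cis (- (x \<bullet> y)))) \<in> C1_closure B (trig (ball y r))"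
    by (rule C1_closure_mult[OF gcis M' _ _ trig_mult])
      (use C1_bound_cis_inner[of B "-y"] in \<open>auto simp: dist_norm\<close>)
  thus ?thesis by (simp add: mult.assoc cis_mult)
qed

end

subsection \<open>Fourier integrals over small balls\<close>

lemma cmod_cis_diff_le: "cmod (cis \<alpha> - cis \<beta>) \<le> \<bar>\<alpha> - \<beta>\<bar>"
proof -
  have "cis \<alpha> - cis \<beta> = cis \<beta> * (cis (\<alpha> - \<beta>) - 1)" by (simp add: algebra_simps cis_mult)
  hence "cmod (cis \<alpha> - cis \<beta>) = cmod (cis (\<alpha> - \<beta>) - 1)" by (simp add: norm_mult)
  also have "\<dots> \<le> \<bar>\<alpha> - \<beta>\<bar>" using iexp_approx1[of "\<alpha> - \<beta>" 0] by (simp add: cis_conv_exp)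
  finally show ?thesis .
qed

lemma has_derivativeI_quadratic_remainder:
  assumes D: "bounded_linear D" and rem: "\<And>v. norm (f (x + v) - f x - D v) \<le> C * (norm v)\<^sup>2"
  shows "(f has_derivative D) (at x)"
  unfolding has_derivative_at
proof
  show "(\<lambda>v. norm (f (x + v) - f x - D v) / norm v) \<midarrow>0\<rightarrow> 0"
  proof (rule Lim_null_comparison)
    show "\<forall>\<^sub>F v in at 0. norm (norm (f (x + v) - f x - D v) / norm v) \<le> C * norm v"
    proof (intro always_eventually allI)
      fix v
      show "norm (norm (f (x + v) - f x - D v) / norm v) \<le> C * norm v"
      proof (cases "v = 0")
        case False
        hence "norm (f (x + v) - f x - D v) / norm v \<le> C * (norm v)\<^sup>2 / norm v"
          using rem by (intro divide_right_mono) auto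
        thus ?thesis using False by (simp add: power2_eq_square)
      qed simp
    qed
    show "((\<lambda>v. C * norm v) \<longlongrightarrow> 0) (at 0)" by (auto intro!: tendsto_eq_intros)
  qed
qed (rule D)

locale integrable_density =
  fixes mu :: "'a::euclidean_space measure" and h :: "'a \<Rightarrow> complex"
  assumes sets_mu[measurable_cong, simp]: "sets mu = sets borel"
    and h_int: "integrable mu h"
begin

lemma h_meas[measurable]: "h \<in> borel_measurable mu"
  using h_int by simp

text \<open>Continuity provides measurability, whereas boundedness is asked only on the ball. This
  admits the factor \<open>v \<bullet> \<zeta>\<close> of the differentiated kernel, which is
  unbounded in general.\<close>

lemma integrable_on_ball:
  assumes f: "continuous_on UNIV f" "\<And>\<zeta>. \<zeta> \<in> ball \<xi> \<eta> \<Longrightarrow> cmod (f \<zeta>) \<le> C"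
  shows "integrable mu (\<lambda>\<zeta>. indicator (ball \<xi> \<eta>) \<zeta> * (f \<zeta> * h \<zeta>))"
    and "cmod (LINT \<zeta>|mu. indicator (ball \<xi> \<eta>) \<zeta> * (f \<zeta> * h \<zeta>)) \<le>
      C * (LINT \<zeta>|mu. indicator (ball \<xi> \<eta>) \<zeta> * cmod (h \<zeta>))"
proof -
  have "f \<in> borel_measurable borel" by (rule borel_measurable_continuous_onI[OF f(1)])
  hence [measurable]: "f \<in> borel_measurable mu" by (simp add: measurable_cong_sets[OF sets_mu refl])
  have [measurable]: "ball \<xi> \<eta> \<in> sets mu" by simp
  have int': "integrable mu (\<lambda>\<zeta>. indicator (ball \<xi> \<eta>) \<zeta> * cmod (h \<zeta>))"
    by (rule Bochner_Integration.integrable_bound[OF h_int]) (auto simp: indicator_def)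
  have le: "cmod (indicator (ball \<xi> \<eta>) \<zeta> * (f \<zeta> * h \<zeta>)) \<le> C * (indicator (ball \<xi> \<eta>) \<zeta> * cmod (h \<zeta>))" for \<zeta>
    using mult_right_mono[OF f(2)[of \<zeta>] norm_ge_zero[of "h \<zeta>"]] by (auto simp: indicator_def norm_mult)
  show int: "integrable mu (\<lambda>\<zeta>. indicator (ball \<xi> \<eta>) \<zeta> * (f \<zeta> * h \<zeta>))"
  proof (rule Bochner_Integration.integrable_bound[OF integrable_mult_right[OF int']])
    show "AE \<zeta> in mu. cmod (indicator (ball \<xi> \<eta>) \<zeta> * (f \<zeta> * h \<zeta>)) \<le> norm (C * (indicator (ball \<xi> \<eta>) \<zeta> * cmod (h \<zeta>)))"
      using le by (auto intro!: order_trans[OF le])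
  qed measurable
  have "cmod (LINT \<zeta>|mu. indicator (ball \<xi> \<eta>) \<zeta> * (f \<zeta> * h \<zeta>)) \<le>
     (LINT \<zeta>|mu. C * (indicator (ball \<xi> \<eta>) \<zeta> * cmod (h \<zeta>)))"
    by (rule Bochner_Integration.integral_norm_bound_integral[OF int integrable_mult_right[OF int']]) (rule le)
  thus "cmod (LINT \<zeta>|mu. indicator (ball \<xi> \<eta>) \<zeta> * (f \<zeta> * h \<zeta>)) \<le>
      C * (LINT \<zeta>|mu. indicator (ball \<xi> \<eta>) \<zeta> * cmod (h \<zeta>))" by simp
qed

lemma continuous_cis_inner: "continuous_on A (\<lambda>\<zeta>. cis (- (x \<bullet> \<zeta>)))" for x :: 'a
  by (intro continuous_intros)

text \<open>No moment of \<open>mu\<close> is assumed. On the ball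
  \<open>|v \<bullet> \<zeta>|\<close> is at most \<open>N * norm v\<close>, so the Taylor remainder
  of the kernel is at most \<open>(N * norm v)\<^sup>2 / 2\<close>, uniformly in
  \<open>\<zeta>\<close>, and integrating it leaves a quadratic remainder.\<close>

lemma local_fourier_has_derivative:
  fixes x :: 'a
  shows "((\<lambda>x. LINT \<zeta>|mu. indicator (ball \<xi> \<eta>) \<zeta> * (cis (- (x \<bullet> \<zeta>)) * h \<zeta>)) has_derivative
    (\<lambda>v. LINT \<zeta>|mu. indicator (ball \<xi> \<eta>) \<zeta> * ((- \<i> * complex_of_real (v \<bullet> \<zeta>) * cis (- (x \<bullet> \<zeta>))) * h \<zeta>))) (at x)"
proof -
  define I where "I = (LINT \<zeta>|mu. indicator (ball \<xi> \<eta>) \<zeta> * cmod (h \<zeta>))"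
  define N where "N = norm \<xi> + \<eta>"
  have N: "\<bar>v \<bullet> \<zeta>\<bar> \<le> N * norm v" if "\<zeta> \<in> ball \<xi> \<eta>" for v \<zeta>
  proof -
    have "norm \<zeta> \<le> N" using that norm_triangle_ineq2[of \<zeta> \<xi>] by (auto simp: N_def dist_norm norm_minus_commute)
    thus ?thesis
      using Cauchy_Schwarz_ineq2[of v \<zeta>] mult_right_mono[of "norm \<zeta>" N "norm v"] by (simp add: mult.commute)
  qed
  have cont: "continuous_on UNIV (\<lambda>\<zeta>. - \<i> * complex_of_real (v \<bullet> \<zeta>) * cis (- (x \<bullet> \<zeta>)))" for v
    by (intro continuous_intros)
  have bd: "cmod (- \<i> * complex_of_real (v \<bullet> \<zeta>) * cis (- (x \<bullet> \<zeta>))) \<le> N * norm v" if "\<zeta> \<in> ball \<xi> \<eta>" for v \<zeta>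
    using N[OF that] by (simp add: norm_mult)
  have int: "integrable mu (\<lambda>\<zeta>. indicator (ball \<xi> \<eta>) \<zeta> * ((- \<i> * complex_of_real (v \<bullet> \<zeta>) * cis (- (x \<bullet> \<zeta>))) * h \<zeta>))"
    "cmod (LINT \<zeta>|mu. indicator (ball \<xi> \<eta>) \<zeta> * ((- \<i> * complex_of_real (v \<bullet> \<zeta>) * cis (- (x \<bullet> \<zeta>))) * h \<zeta>)) \<le>
       (N * norm v) * (LINT \<zeta>|mu. indicator (ball \<xi> \<eta>) \<zeta> * cmod (h \<zeta>))" for v
    by (rule integrable_on_ball[OF cont], erule bd)+
  have int0: "integrable mu (\<lambda>\<zeta>. indicator (ball \<xi> \<eta>) \<zeta> * (cis (- (x \<bullet> \<zeta>)) * h \<zeta>))" for x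
    by (rule integrable_on_ball[where C=1, OF continuous_cis_inner]) auto
  show ?thesis
  proof (rule has_derivativeI_quadratic_remainder)
    show "bounded_linear (\<lambda>v. LINT \<zeta>|mu. indicator (ball \<xi> \<eta>) \<zeta> * ((- \<i> * complex_of_real (v \<bullet> \<zeta>) * cis (- (x \<bullet> \<zeta>))) * h \<zeta>))"
    proof (rule bounded_linear_intro[where K="N * I"])
      fix v w :: 'a and r :: real
      show "(LINT \<zeta>|mu. indicator (ball \<xi> \<eta>) \<zeta> * ((- \<i> * complex_of_real ((v + w) \<bullet> \<zeta>) * cis (- (x \<bullet> \<zeta>))) * h \<zeta>)) =
        (LINT \<zeta>|mu. indicator (ball \<xi> \<eta>) \<zeta> * ((- \<i> * complex_of_real (v \<bullet> \<zeta>) * cis (- (x \<bullet> \<zeta>))) * h \<zeta>)) +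
        (LINT \<zeta>|mu. indicator (ball \<xi> \<eta>) \<zeta> * ((- \<i> * complex_of_real (w \<bullet> \<zeta>) * cis (- (x \<bullet> \<zeta>))) * h \<zeta>))"
        by (subst Bochner_Integration.integral_add[OF int(1) int(1), symmetric])
          (simp_all add: inner_add_left algebra_simps)
      show "(LINT \<zeta>|mu. indicator (ball \<xi> \<eta>) \<zeta> * ((- \<i> * complex_of_real ((r *\<^sub>R v) \<bullet> \<zeta>) * cis (- (x \<bullet> \<zeta>))) * h \<zeta>)) =
        r *\<^sub>R (LINT \<zeta>|mu. indicator (ball \<xi> \<eta>) \<zeta> * ((- \<i> * complex_of_real (v \<bullet> \<zeta>) * cis (- (x \<bullet> \<zeta>))) * h \<zeta>))"
        by (subst integral_scaleR_right[symmetric]) (simp add: scaleR_conv_of_real mult_ac)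
      show "norm (LINT \<zeta>|mu. indicator (ball \<xi> \<eta>) \<zeta> * ((- \<i> * complex_of_real (v \<bullet> \<zeta>) * cis (- (x \<bullet> \<zeta>))) * h \<zeta>)) \<le> norm v * (N * I)"
        using int(2)[of v] unfolding I_def by (simp add: mult_ac)
    qed
    fix v
    let ?R = "\<lambda>\<zeta>. cis (- ((x + v) \<bullet> \<zeta>)) - cis (- (x \<bullet> \<zeta>)) - (- \<i> * complex_of_real (v \<bullet> \<zeta>) * cis (- (x \<bullet> \<zeta>)))"
    have eq: "(LINT \<zeta>|mu. indicator (ball \<xi> \<eta>) \<zeta> * (cis (- ((x + v) \<bullet> \<zeta>)) * h \<zeta>)) -
       (LINT \<zeta>|mu. indicator (ball \<xi> \<eta>) \<zeta> * (cis (- (x \<bullet> \<zeta>)) * h \<zeta>)) -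
       (LINT \<zeta>|mu. indicator (ball \<xi> \<eta>) \<zeta> * ((- \<i> * complex_of_real (v \<bullet> \<zeta>) * cis (- (x \<bullet> \<zeta>))) * h \<zeta>)) =
       (LINT \<zeta>|mu. indicator (ball \<xi> \<eta>) \<zeta> * (?R \<zeta> * h \<zeta>))"
      by (subst Bochner_Integration.integral_diff[symmetric]; (intro Bochner_Integration.integrable_diff int0 int(1))?)+
        (simp add: algebra_simps)
    have contR: "continuous_on UNIV ?R" by (intro continuous_intros)
    have R: "cmod (?R \<zeta>) \<le> (N * norm v)\<^sup>2 / 2" if "\<zeta> \<in> ball \<xi> \<eta>" for \<zeta>
    proof -
      define t where "t = - (v \<bullet> \<zeta>)"
      have "(\<Sum>k\<le>1. (\<i> * t) ^ k / fact k) = 1 + \<i> * t" by (simp add: numeral_eq_Suc)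
      hence "cmod (cis t - (1 + \<i> * t)) \<le> t\<^sup>2 / 2"
        using iexp_approx1[of t 1] by (simp add: power2_eq_square cis_conv_exp)
      also have "\<dots> \<le> (N * norm v)\<^sup>2 / 2"
        using N[OF that, of v] by (simp add: t_def abs_le_square_iff[symmetric])
      finally have *: "cmod (cis t - (1 + \<i> * t)) \<le> (N * norm v)\<^sup>2 / 2" .
      have "?R \<zeta> = cis (- (x \<bullet> \<zeta>)) * (cis t - (1 + \<i> * t))"
        by (simp add: t_def inner_add_left cis_mult algebra_simps)
      thus ?thesis using * by (simp add: norm_mult)
    qed
    have "cmod (LINT \<zeta>|mu. indicator (ball \<xi> \<eta>) \<zeta> * (?R \<zeta> * h \<zeta>)) \<le> (N * norm v)\<^sup>2 / 2 * I"
      unfolding I_def by (rule integrable_on_ball(2)[OF contR R])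
    thus "cmod ((LINT \<zeta>|mu. indicator (ball \<xi> \<eta>) \<zeta> * (cis (- ((x + v) \<bullet> \<zeta>)) * h \<zeta>)) -
       (LINT \<zeta>|mu. indicator (ball \<xi> \<eta>) \<zeta> * (cis (- (x \<bullet> \<zeta>)) * h \<zeta>)) -
       (LINT \<zeta>|mu. indicator (ball \<xi> \<eta>) \<zeta> * ((- \<i> * complex_of_real (v \<bullet> \<zeta>) * cis (- (x \<bullet> \<zeta>))) * h \<zeta>)))
       \<le> (N\<^sup>2 / 2 * I) * (norm v)\<^sup>2"
      unfolding eq by (simp add: power_mult_distrib mult_ac)
  qed
qed

text \<open>The kernel is frozen at the centre of the ball. This costs \<open>R * \<eta>\<close> in
  the values; in the derivative it costs \<open>\<eta>\<close> from the factor
  \<open>v \<bullet> \<zeta>\<close> and \<open>R * norm \<xi> * \<eta>\<close> from the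
  exponential, per unit of \<open>v\<close>. The stated constant dominates both.\<close>

lemma C1_bound_local_fourier:
  assumes B: "\<And>x. x \<in> B \<Longrightarrow> norm x \<le> R" and pos: "\<eta> > 0" "R \<ge> 0"
  shows "C1_bound B (\<eta> * (1 + R + R * norm \<xi>) * (LINT \<zeta>|mu. indicator (ball \<xi> \<eta>) \<zeta> * cmod (h \<zeta>)))
    (\<lambda>x. (LINT \<zeta>|mu. indicator (ball \<xi> \<eta>) \<zeta> * (cis (- (x \<bullet> \<zeta>)) * h \<zeta>)) -
         cis (- (x \<bullet> \<xi>)) * (LINT \<zeta>|mu. indicator (ball \<xi> \<eta>) \<zeta> * h \<zeta>))"
proof (rule C1_boundI)
  define I where "I = (LINT \<zeta>|mu. indicator (ball \<xi> \<eta>) \<zeta> * cmod (h \<zeta>))"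
  define A where "A = (LINT \<zeta>|mu. indicator (ball \<xi> \<eta>) \<zeta> * h \<zeta>)"
  have I: "I \<ge> 0" unfolding I_def by (intro integral_nonneg_AE) auto
  have int0: "integrable mu (\<lambda>\<zeta>. indicator (ball \<xi> \<eta>) \<zeta> * (cis (- (x \<bullet> \<zeta>)) * h \<zeta>))" for x
    by (rule integrable_on_ball[where C=1, OF continuous_cis_inner]) auto
  have intc: "integrable mu (\<lambda>\<zeta>. indicator (ball \<xi> \<eta>) \<zeta> * (c * h \<zeta>))" for c
    by (rule integrable_on_ball[where C="cmod c", OF continuous_on_const]) auto
  have cA: "c * A = (LINT \<zeta>|mu. indicator (ball \<xi> \<eta>) \<zeta> * (c * h \<zeta>))" for c
    unfolding A_def by (subst integral_mult_right_zero[symmetric]) (simp add: mult_ac)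
  have diff_inner: "\<bar>u \<bullet> \<zeta> - u \<bullet> \<xi>\<bar> \<le> norm u * \<eta>" if "\<zeta> \<in> ball \<xi> \<eta>" for u \<zeta>
  proof -
    have "\<bar>u \<bullet> (\<zeta> - \<xi>)\<bar> \<le> norm u * norm (\<zeta> - \<xi>)" by (rule Cauchy_Schwarz_ineq2)
    also have "\<dots> \<le> norm u * \<eta>" using that by (intro mult_left_mono) (auto simp: dist_norm norm_minus_commute)
    finally show ?thesis by (simp add: inner_diff_right)
  qed
  fix x assume x: "x \<in> B"
  have cis_diff: "cmod (cis (- (x \<bullet> \<zeta>)) - cis (- (x \<bullet> \<xi>))) \<le> R * \<eta>" if "\<zeta> \<in> ball \<xi> \<eta>" for \<zeta>
    using cmod_cis_diff_le[of "- (x \<bullet> \<zeta>)" "- (x \<bullet> \<xi>)"] diff_inner[OF that, of x]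
      mult_right_mono[OF B[OF x], of \<eta>] pos by linarith
  show "cmod ((LINT \<zeta>|mu. indicator (ball \<xi> \<eta>) \<zeta> * (cis (- (x \<bullet> \<zeta>)) * h \<zeta>)) - cis (- (x \<bullet> \<xi>)) * A)
     \<le> \<eta> * (1 + R + R * norm \<xi>) * I"
  proof -
    have "(LINT \<zeta>|mu. indicator (ball \<xi> \<eta>) \<zeta> * (cis (- (x \<bullet> \<zeta>)) * h \<zeta>)) - cis (- (x \<bullet> \<xi>)) * A =
      (LINT \<zeta>|mu. indicator (ball \<xi> \<eta>) \<zeta> * ((cis (- (x \<bullet> \<zeta>)) - cis (- (x \<bullet> \<xi>))) * h \<zeta>))"
      unfolding cA by (subst Bochner_Integration.integral_diff[OF int0 intc, symmetric]) (simp add: algebra_simps)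
    also have "cmod \<dots> \<le> (R * \<eta>) * I" unfolding I_def
      by (rule integrable_on_ball(2)[OF _ cis_diff]) (intro continuous_intros)
    also have "\<dots> \<le> \<eta> * (1 + R + R * norm \<xi>) * I"
      using pos I by (intro mult_right_mono) (auto simp: algebra_simps)
    finally show ?thesis .
  qed
  have der_cis: "((\<lambda>x. cis (- (x \<bullet> \<xi>)) * A) has_derivative (\<lambda>v. (- \<i> * complex_of_real (v \<bullet> \<xi>) * cis (- (x \<bullet> \<xi>))) * A)) (at x)"
    by (auto intro!: derivative_eq_intros simp: scaleR_conv_of_real)
  show "((\<lambda>x. (LINT \<zeta>|mu. indicator (ball \<xi> \<eta>) \<zeta> * (cis (- (x \<bullet> \<zeta>)) * h \<zeta>)) - cis (- (x \<bullet> \<xi>)) * A) has_derivative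
     (\<lambda>v. (LINT \<zeta>|mu. indicator (ball \<xi> \<eta>) \<zeta> * ((- \<i> * complex_of_real (v \<bullet> \<zeta>) * cis (- (x \<bullet> \<zeta>))) * h \<zeta>)) -
       (- \<i> * complex_of_real (v \<bullet> \<xi>) * cis (- (x \<bullet> \<xi>))) * A)) (at x)"
    by (rule has_derivative_diff[OF local_fourier_has_derivative der_cis])
  fix v
  define d where "d \<zeta> = (- \<i> * complex_of_real (v \<bullet> \<zeta>) * cis (- (x \<bullet> \<zeta>)))" for \<zeta>
  have contd: "continuous_on UNIV d" unfolding d_def by (intro continuous_intros)
  have dd: "cmod (d \<zeta> - d \<xi>) \<le> \<eta> * (1 + R + R * norm \<xi>) * norm v" if "\<zeta> \<in> ball \<xi> \<eta>" for \<zeta>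
  proof -
    have "d \<zeta> - d \<xi> = - \<i> * (complex_of_real (v \<bullet> \<zeta> - v \<bullet> \<xi>) * cis (- (x \<bullet> \<zeta>)) +
       complex_of_real (v \<bullet> \<xi>) * (cis (- (x \<bullet> \<zeta>)) - cis (- (x \<bullet> \<xi>))))"
      by (simp add: d_def algebra_simps)
    hence "cmod (d \<zeta> - d \<xi>) \<le> \<bar>v \<bullet> \<zeta> - v \<bullet> \<xi>\<bar> + \<bar>v \<bullet> \<xi>\<bar> * cmod (cis (- (x \<bullet> \<zeta>)) - cis (- (x \<bullet> \<xi>)))"
      using norm_triangle_ineq[of "complex_of_real (v \<bullet> \<zeta> - v \<bullet> \<xi>) * cis (- (x \<bullet> \<zeta>))"
         "complex_of_real (v \<bullet> \<xi>) * (cis (- (x \<bullet> \<zeta>)) - cis (- (x \<bullet> \<xi>)))"]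
      by (simp add: norm_mult del: of_real_diff)
    also have "\<dots> \<le> norm v * \<eta> + (norm v * norm \<xi>) * (R * \<eta>)"
      using diff_inner[OF that] cis_diff[OF that] Cauchy_Schwarz_ineq2[of v \<xi>] pos
      by (intro add_mono mult_mono) auto
    also have "\<dots> \<le> \<eta> * (1 + R + R * norm \<xi>) * norm v" using pos by (simp add: algebra_simps)
    finally show ?thesis .
  qed
  have intd: "integrable mu (\<lambda>\<zeta>. indicator (ball \<xi> \<eta>) \<zeta> * (d \<zeta> * h \<zeta>))"
  proof (rule integrable_on_ball[OF contd])
    fix \<zeta> assume "\<zeta> \<in> ball \<xi> \<eta>"
    from dd[OF this] norm_triangle_ineq[of "d \<zeta> - d \<xi>" "d \<xi>"]
    show "cmod (d \<zeta>) \<le> \<eta> * (1 + R + R * norm \<xi>) * norm v + cmod (d \<xi>)" by simp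
  qed
  have "(LINT \<zeta>|mu. indicator (ball \<xi> \<eta>) \<zeta> * (d \<zeta> * h \<zeta>)) - d \<xi> * A =
    (LINT \<zeta>|mu. indicator (ball \<xi> \<eta>) \<zeta> * ((d \<zeta> - d \<xi>) * h \<zeta>))"
    unfolding cA by (subst Bochner_Integration.integral_diff[OF intd intc, symmetric]) (simp add: algebra_simps)
  also have "cmod \<dots> \<le> (\<eta> * (1 + R + R * norm \<xi>) * norm v) * I" unfolding I_def
    by (rule integrable_on_ball(2)[OF _ dd]) (intro continuous_intros contd)
  finally show "cmod ((LINT \<zeta>|mu. indicator (ball \<xi> \<eta>) \<zeta> * ((- \<i> * complex_of_real (v \<bullet> \<zeta>) * cis (- (x \<bullet> \<zeta>))) * h \<zeta>)) -
       (- \<i> * complex_of_real (v \<bullet> \<xi>) * cis (- (x \<bullet> \<xi>))) * A) \<le> \<eta> * (1 + R + R * norm \<xi>) * I * norm v"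
    unfolding d_def by (simp add: mult_ac)
qed

end

subsection \<open>Symmetry of spectral measures of real fields\<close>

text \<open>For an entry of the spectral density the integral in \<open>real\<close> is a covariance
  of the field, hence a real number.\<close>

locale real_spectral_density = integrable_density +
  assumes real: "\<And>z. Im (LINT \<xi>|mu. cis (z \<bullet> \<xi>) * h \<xi>) = 0"
begin

text \<open>The measure \<open>\<rho> = h mu\<close> satisfies \<open>\<rho> (- U) = cnj (\<rho> U)\<close> because its Fourier transform is real.
  Uniqueness of Fourier transforms is replaced by testing the identity on functions \<open>\<phi>\<close>: it holds for
  \<open>\<phi> = 1\<close>, and the functions by which \<open>\<phi>\<close> may be multiplied form an algebra that contains the cosines and is
  closed under bounded pointwise limits.\<close>

definition hermitian :: "('a \<Rightarrow> real) \<Rightarrow> bool" where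
  "hermitian \<phi> \<longleftrightarrow> (\<forall>z. (LINT \<xi>|mu. complex_of_real (\<phi> (- \<xi>)) * (cis (z \<bullet> \<xi>) * h \<xi>)) =
     cnj (LINT \<xi>|mu. complex_of_real (\<phi> \<xi>) * (cis (z \<bullet> \<xi>) * h \<xi>)))"

definition bounded_borel :: "('a \<Rightarrow> real) \<Rightarrow> bool" where
  "bounded_borel \<phi> \<longleftrightarrow> \<phi> \<in> borel_measurable borel \<and> (\<exists>C. \<forall>x. \<bar>\<phi> x\<bar> \<le> C)"

text \<open>Hermitian functions are not visibly closed under products, but the operations of
  multiplication that preserve them compose.\<close>

definition multiplier :: "('a \<Rightarrow> real) \<Rightarrow> bool" where
  "multiplier u \<longleftrightarrow> bounded_borel u \<and> (\<forall>\<phi>. bounded_borel \<phi> \<longrightarrow> hermitian \<phi> \<longrightarrow> hermitian (\<lambda>x. u x * \<phi> x))"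

lemma integrable_bounded_borel:
  assumes "bounded_borel \<phi>"
  shows "integrable mu (\<lambda>\<xi>. complex_of_real (\<phi> \<xi>) * (cis (z \<bullet> \<xi>) * h \<xi>))"
    and "integrable mu (\<lambda>\<xi>. complex_of_real (\<phi> (- \<xi>)) * (cis (z \<bullet> \<xi>) * h \<xi>))"
proof -
  from assms obtain C where C[measurable]: "\<phi> \<in> borel_measurable borel" and "\<And>x. \<bar>\<phi> x\<bar> \<le> C"
    unfolding bounded_borel_def by blast
  hence C': "\<bar>\<phi> x\<bar> \<le> \<bar>C\<bar>" for x by (meson abs_ge_self order_trans)
  have cis[measurable]: "(\<lambda>\<xi>. cis (z \<bullet> \<xi>)) \<in> borel_measurable borel"
    by (intro borel_measurable_continuous_onI continuous_intros)
  have [measurable]: "(uminus :: 'a \<Rightarrow> 'a) \<in> borel_measurable borel"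
    by (intro borel_measurable_continuous_onI continuous_intros)
  have int: "integrable mu (\<lambda>\<xi>. complex_of_real C * h \<xi>)" using h_int by simp
  show "integrable mu (\<lambda>\<xi>. complex_of_real (\<phi> \<xi>) * (cis (z \<bullet> \<xi>) * h \<xi>))"
    by (rule Bochner_Integration.integrable_bound[OF int])
      (use C' in \<open>auto simp: norm_mult intro!: mult_right_mono\<close>)
  show "integrable mu (\<lambda>\<xi>. complex_of_real (\<phi> (- \<xi>)) * (cis (z \<bullet> \<xi>) * h \<xi>))"
    by (rule Bochner_Integration.integrable_bound[OF int])
      (use C' in \<open>auto simp: norm_mult intro!: mult_right_mono\<close>)
qed

lemma bounded_borel_const: "bounded_borel (\<lambda>x. c)"
  unfolding bounded_borel_def by (auto intro!: exI[of _ "\<bar>c\<bar>"])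

lemma bounded_borel_add: "bounded_borel u \<Longrightarrow> bounded_borel v \<Longrightarrow> bounded_borel (\<lambda>x. u x + v x)"
  unfolding bounded_borel_def by (auto, metis abs_triangle_ineq add_mono order_trans)

lemma bounded_borel_mult:
  assumes "bounded_borel u" "bounded_borel v"
  shows "bounded_borel (\<lambda>x. u x * v x)"
proof -
  from assms obtain C C' where *: "\<And>x. \<bar>u x\<bar> \<le> C" "\<And>x. \<bar>v x\<bar> \<le> C'"
    and "u \<in> borel_measurable borel" "v \<in> borel_measurable borel" unfolding bounded_borel_def by blast
  moreover have "\<bar>u x * v x\<bar> \<le> C * C'" for x
    using mult_mono[OF *(1)[of x] *(2)[of x]] order_trans[OF abs_ge_zero *(1)[of x]] by (simp add: abs_mult)
  ultimately show ?thesis unfolding bounded_borel_def by auto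
qed

lemma hermitian_add:
  assumes "bounded_borel u" "bounded_borel v" "hermitian u" "hermitian v"
  shows "hermitian (\<lambda>x. u x + v x)"
  using assms unfolding hermitian_def
  by (simp add: ring_distribs Bochner_Integration.integral_add integrable_bounded_borel)

lemma hermitian_const_mult: "hermitian u \<Longrightarrow> hermitian (\<lambda>x. c * u x)"
  unfolding hermitian_def by (simp add: mult.assoc)

lemma hermitian_limit:
  assumes bb: "\<And>k. bounded_borel (\<phi> k)" and herm: "\<And>k. hermitian (\<phi> k)"
    and C: "\<And>k x. \<bar>\<phi> k x\<bar> \<le> C" and lim: "\<And>x. (\<lambda>k. \<phi> k x) \<longlonglongrightarrow> \<phi>' x"
  shows "hermitian \<phi>'"
  unfolding hermitian_def
proof
  fix z :: 'a
  have [measurable]: "\<phi> k \<in> borel_measurable borel" for k using bb[of k] by (simp add: bounded_borel_def)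
  have meas[measurable]: "\<phi>' \<in> borel_measurable borel" by (rule borel_measurable_LIMSEQ_real[OF lim]) auto
  have cis[measurable]: "(\<lambda>\<xi>. cis (z \<bullet> \<xi>)) \<in> borel_measurable borel"
    by (intro borel_measurable_continuous_onI continuous_intros)
  have [measurable]: "(uminus :: 'a \<Rightarrow> 'a) \<in> borel_measurable borel"
    by (intro borel_measurable_continuous_onI continuous_intros)
  have C': "\<bar>\<phi> k x\<bar> \<le> \<bar>C\<bar>" for k x using C by (meson abs_ge_self order_trans)
  have 1: "(\<lambda>k. LINT \<xi>|mu. complex_of_real (\<phi> k \<xi>) * (cis (z \<bullet> \<xi>) * h \<xi>)) \<longlonglongrightarrow>
     (LINT \<xi>|mu. complex_of_real (\<phi>' \<xi>) * (cis (z \<bullet> \<xi>) * h \<xi>))"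
    by (rule integral_dominated_convergence[where w="\<lambda>\<xi>. \<bar>C\<bar> * norm (h \<xi>)"])
      (use h_int C' in \<open>auto simp: norm_mult intro!: mult_right_mono tendsto_intros lim\<close>)
  have 2: "(\<lambda>k. LINT \<xi>|mu. complex_of_real (\<phi> k (- \<xi>)) * (cis (z \<bullet> \<xi>) * h \<xi>)) \<longlonglongrightarrow>
     (LINT \<xi>|mu. complex_of_real (\<phi>' (- \<xi>)) * (cis (z \<bullet> \<xi>) * h \<xi>))"
    by (rule integral_dominated_convergence[where w="\<lambda>\<xi>. \<bar>C\<bar> * norm (h \<xi>)"])
      (use h_int C' in \<open>auto simp: norm_mult intro!: mult_right_mono tendsto_intros lim\<close>)
  have "(\<lambda>k. LINT \<xi>|mu. complex_of_real (\<phi> k (- \<xi>)) * (cis (z \<bullet> \<xi>) * h \<xi>)) \<longlonglongrightarrow>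
     cnj (LINT \<xi>|mu. complex_of_real (\<phi>' \<xi>) * (cis (z \<bullet> \<xi>) * h \<xi>))"
    using tendsto_cnj[OF 1] herm unfolding hermitian_def by simp
  from LIMSEQ_unique[OF 2 this]
  show "(LINT \<xi>|mu. complex_of_real (\<phi>' (- \<xi>)) * (cis (z \<bullet> \<xi>) * h \<xi>)) =
     cnj (LINT \<xi>|mu. complex_of_real (\<phi>' \<xi>) * (cis (z \<bullet> \<xi>) * h \<xi>))" .
qed

lemma multiplier_const: "multiplier (\<lambda>x. c)"
  unfolding multiplier_def by (simp add: bounded_borel_const hermitian_const_mult)

lemma multiplier_add: "multiplier u \<Longrightarrow> multiplier v \<Longrightarrow> multiplier (\<lambda>x. u x + v x)"
  unfolding multiplier_def
  by (auto simp: distrib_right intro!: bounded_borel_add bounded_borel_mult hermitian_add)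

lemma multiplier_mult: "multiplier u \<Longrightarrow> multiplier v \<Longrightarrow> multiplier (\<lambda>x. u x * v x)"
  unfolding multiplier_def
  by (auto simp: mult.assoc intro!: bounded_borel_mult)

lemma multiplier_sum: "(\<And>i. i \<in> I \<Longrightarrow> multiplier (u i)) \<Longrightarrow> multiplier (\<lambda>x. \<Sum>i\<in>I. u i x)"
  by (induction I rule: infinite_finite_induct) (auto intro: multiplier_const multiplier_add)

lemma multiplier_power: "multiplier u \<Longrightarrow> multiplier (\<lambda>x. u x ^ n)"
  by (induction n) (auto intro: multiplier_const multiplier_mult)

lemma multiplier_limit:
  assumes u: "\<And>k. multiplier (u k)"
    and C: "\<And>k x. \<bar>u k x\<bar> \<le> C" and lim: "\<And>x. (\<lambda>k. u k x) \<longlonglongrightarrow> u' x"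
  shows "multiplier u'"
  unfolding multiplier_def
proof (intro conjI allI impI)
  have [measurable]: "u k \<in> borel_measurable borel" for k
    using u[of k] by (simp add: bounded_borel_def multiplier_def)
  have "\<bar>u' x\<bar> \<le> C" for x
    by (rule LIMSEQ_le_const2[OF tendsto_rabs[OF lim]]) (use C in auto)
  moreover have "u' \<in> borel_measurable borel" by (rule borel_measurable_LIMSEQ_real[OF lim]) auto
  ultimately show "bounded_borel u'" unfolding bounded_borel_def by blast
  fix \<phi> assume \<phi>: "bounded_borel \<phi>" "hermitian \<phi>"
  from \<phi>(1) obtain C' where C': "\<And>x. \<bar>\<phi> x\<bar> \<le> C'" unfolding bounded_borel_def by blast
  show "hermitian (\<lambda>x. u' x * \<phi> x)"
  proof (rule hermitian_limit)
    show "bounded_borel (\<lambda>x. u k x * \<phi> x)" "hermitian (\<lambda>x. u k x * \<phi> x)" for k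
      using u[of k] \<phi> by (auto simp: multiplier_def intro: bounded_borel_mult)
    show "\<bar>u k x * \<phi> x\<bar> \<le> C * C'" for k x
      using mult_mono[OF C[of k x] C'[of x]] order_trans[OF abs_ge_zero C[of k x]] by (simp add: abs_mult)
    show "(\<lambda>k. u k x * \<phi> x) \<longlonglongrightarrow> u' x * \<phi> x" for x by (intro tendsto_intros lim)
  qed
qed

text \<open>Multiplying by a cosine shifts \<open>z\<close> by \<open>\<theta>\<close> and
  \<open>- \<theta>\<close>, which is why \<open>hermitian\<close> quantifies over all
  \<open>z\<close>. Reflection exchanges the two shifts, and conjugation makes up for this by
  exchanging \<open>cis b\<close> and \<open>cis (- b)\<close>.\<close>

lemma multiplier_cos: "multiplier (\<lambda>x. cos (\<theta> \<bullet> x + b))"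
  unfolding multiplier_def
proof (intro conjI allI impI)
  show "bounded_borel (\<lambda>x. cos (\<theta> \<bullet> x + b))" unfolding bounded_borel_def
    by (auto intro!: exI[of _ 1] borel_measurable_continuous_onI continuous_intros)
  fix \<phi> assume \<phi>: "bounded_borel \<phi>" "hermitian \<phi>"
  note int = integrable_bounded_borel[OF \<phi>(1)]
  show "hermitian (\<lambda>x. cos (\<theta> \<bullet> x + b) * \<phi> x)"
    unfolding hermitian_def
  proof
    fix z :: 'a
    define J where "J z = (LINT \<xi>|mu. complex_of_real (\<phi> \<xi>) * (cis (z \<bullet> \<xi>) * h \<xi>))" for z
    define J' where "J' z = (LINT \<xi>|mu. complex_of_real (\<phi> (- \<xi>)) * (cis (z \<bullet> \<xi>) * h \<xi>))" for z
    have J': "J' z = cnj (J z)" for z using \<phi>(2) by (simp add: hermitian_def J_def J'_def)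
    have cos: "complex_of_real (cos t) = (cis t + cis (- t)) / 2" for t
      by (simp add: complex_eq_iff)
    have 1: "complex_of_real (cos (\<theta> \<bullet> \<xi> + b) * \<phi> \<xi>) * (cis (z \<bullet> \<xi>) * h \<xi>) =
       cis b / 2 * (complex_of_real (\<phi> \<xi>) * (cis ((z + \<theta>) \<bullet> \<xi>) * h \<xi>)) +
       cis (- b) / 2 * (complex_of_real (\<phi> \<xi>) * (cis ((z - \<theta>) \<bullet> \<xi>) * h \<xi>))" for \<xi>
    proof -
      have "cis (\<theta> \<bullet> \<xi> + b) = cis (\<theta> \<bullet> \<xi>) * cis b" "cis (- (\<theta> \<bullet> \<xi> + b)) = cis (- (\<theta> \<bullet> \<xi>)) * cis (- b)"
        "cis ((z + \<theta>) \<bullet> \<xi>) = cis (z \<bullet> \<xi>) * cis (\<theta> \<bullet> \<xi>)" "cis ((z - \<theta>) \<bullet> \<xi>) = cis (z \<bullet> \<xi>) * cis (- (\<theta> \<bullet> \<xi>))"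
        by (simp_all add: cis_mult inner_add_left inner_diff_left)
      thus ?thesis by (simp only: of_real_mult cos) (simp add: field_simps)
    qed
    have 2: "complex_of_real (cos (\<theta> \<bullet> (- \<xi>) + b) * \<phi> (- \<xi>)) * (cis (z \<bullet> \<xi>) * h \<xi>) =
       cis b / 2 * (complex_of_real (\<phi> (- \<xi>)) * (cis ((z - \<theta>) \<bullet> \<xi>) * h \<xi>)) +
       cis (- b) / 2 * (complex_of_real (\<phi> (- \<xi>)) * (cis ((z + \<theta>) \<bullet> \<xi>) * h \<xi>))" for \<xi>
    proof -
      have "cis (\<theta> \<bullet> (- \<xi>) + b) = cis (- (\<theta> \<bullet> \<xi>)) * cis b" "cis (- (\<theta> \<bullet> (- \<xi>) + b)) = cis (\<theta> \<bullet> \<xi>) * cis (- b)"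
        "cis ((z + \<theta>) \<bullet> \<xi>) = cis (z \<bullet> \<xi>) * cis (\<theta> \<bullet> \<xi>)" "cis ((z - \<theta>) \<bullet> \<xi>) = cis (z \<bullet> \<xi>) * cis (- (\<theta> \<bullet> \<xi>))"
        by (simp_all add: cis_mult inner_add_left inner_diff_left)
      thus ?thesis by (simp only: of_real_mult cos) (simp add: field_simps)
    qed
    have "(LINT \<xi>|mu. complex_of_real (cos (\<theta> \<bullet> \<xi> + b) * \<phi> \<xi>) * (cis (z \<bullet> \<xi>) * h \<xi>)) =
      cis b / 2 * J (z + \<theta>) + cis (- b) / 2 * J (z - \<theta>)"
      unfolding 1 J_def by (simp add: int)
    moreover have "(LINT \<xi>|mu. complex_of_real (cos (\<theta> \<bullet> (- \<xi>) + b) * \<phi> (- \<xi>)) * (cis (z \<bullet> \<xi>) * h \<xi>)) =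
      cis b / 2 * J' (z - \<theta>) + cis (- b) / 2 * J' (z + \<theta>)"
      unfolding 2 J'_def by (simp add: int)
    ultimately show "(LINT \<xi>|mu. complex_of_real (cos (\<theta> \<bullet> (- \<xi>) + b) * \<phi> (- \<xi>)) * (cis (z \<bullet> \<xi>) * h \<xi>)) =
       cnj (LINT \<xi>|mu. complex_of_real (cos (\<theta> \<bullet> \<xi> + b) * \<phi> \<xi>) * (cis (z \<bullet> \<xi>) * h \<xi>))"
      by (simp add: J' cis_cnj)
  qed
qed

text \<open>The partial sums of the exponential series are polynomials in \<open>u\<close>, all
  bounded by \<open>exp C\<close>, so the limit is a bounded one.\<close>

lemma multiplier_exp:
  assumes u: "multiplier u"
  shows "multiplier (\<lambda>x. exp (u x))"
proof -
  obtain C where C: "\<And>x. \<bar>u x\<bar> \<le> C" using u unfolding multiplier_def bounded_borel_def by blast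
  show ?thesis
  proof (rule multiplier_limit)
    show "multiplier (\<lambda>x. \<Sum>n<N. (1 / fact n) * u x ^ n)" for N
      by (intro multiplier_sum multiplier_mult multiplier_const multiplier_power u)
    show "\<bar>\<Sum>n<N. (1 / fact n) * u x ^ n\<bar> \<le> exp C" for N x
    proof -
      have "\<bar>\<Sum>n<N. (1 / fact n) * u x ^ n\<bar> \<le> (\<Sum>n<N. \<bar>(1 / fact n) * u x ^ n\<bar>)" by (rule sum_abs)
      also have "\<dots> \<le> (\<Sum>n<N. (1 / fact n) * C ^ n)"
        using C by (intro sum_mono) (auto simp: abs_mult power_abs intro!: mult_left_mono divide_right_mono power_mono)
      also have "\<dots> \<le> (\<Sum>n. (1 / fact n) * C ^ n)"
        using summable_exp[of C] order_trans[OF abs_ge_zero C]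
        by (intro sum_le_suminf) (auto simp: divide_inverse)
      also have "\<dots> = exp C" by (simp add: exp_def divide_inverse)
      finally show ?thesis .
    qed
    show "(\<lambda>N. \<Sum>n<N. (1 / fact n) * u x ^ n) \<longlonglongrightarrow> exp (u x)" for x
      using exp_converges[of "u x"] by (simp add: sums_def divide_inverse)
  qed
qed

lemma multiplier_indicator_ball:
  assumes \<rho>: "\<rho> > 0"
  shows "multiplier (indicator (ball y \<rho>))"
proof (rule multiplier_limit)
  \<comment> \<open>\<open>w k x\<close> is a trigonometric polynomial tending to \<open>|x - y|\<^sup>2\<close>, and the indicator is the limit in \<open>p\<close> of
    \<open>exp (- p (|x - y|\<^sup>2 / \<rho>\<^sup>2) ^ p)\<close>.\<close>
  define w where "w k x = (\<Sum>b\<in>Basis. 2 * (real (Suc k))\<^sup>2 * (1 - cos ((x \<bullet> b - y \<bullet> b) / real (Suc k))))" for k x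
  have w: "multiplier (w k)" for k
  proof -
    have "multiplier (\<lambda>x. \<Sum>b\<in>Basis. 2 * (real (Suc k))\<^sup>2 * (1 + (- 1) * cos (((1 / real (Suc k)) *\<^sub>R b) \<bullet> x + (- (y \<bullet> b) / real (Suc k)))))"
      by (intro multiplier_sum multiplier_mult multiplier_add multiplier_const multiplier_cos)
    also have "(\<lambda>x. \<Sum>b\<in>Basis. 2 * (real (Suc k))\<^sup>2 * (1 + (- 1) * cos (((1 / real (Suc k)) *\<^sub>R b) \<bullet> x + (- (y \<bullet> b) / real (Suc k))))) = w k"
      unfolding w_def by (intro ext sum.cong refl) (simp add: inner_commute diff_divide_distrib)
    finally show ?thesis .
  qed
  have w0: "w k x \<ge> 0" for k x unfolding w_def by (intro sum_nonneg) auto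
  have w_lim: "(\<lambda>k. w k x) \<longlonglongrightarrow> (norm (x - y))\<^sup>2" for x
  proof -
    have "(\<lambda>k. 2 * (real (Suc k))\<^sup>2 * (1 - cos (t / real (Suc k)))) \<longlonglongrightarrow> t * t" for t :: real
      by (cases "t = 0"; simp?; real_asymp)
    hence "(\<lambda>k. 2 * (real (Suc k))\<^sup>2 * (1 - cos (t / real (Suc k)))) \<longlonglongrightarrow> t\<^sup>2" for t :: real
      by (simp only: power2_eq_square)
    hence "(\<lambda>k. w k x) \<longlonglongrightarrow> (\<Sum>b\<in>Basis. (x \<bullet> b - y \<bullet> b)\<^sup>2)" unfolding w_def by (intro tendsto_sum)
    also have "(\<Sum>b\<in>Basis. (x \<bullet> b - y \<bullet> b)\<^sup>2) = (norm (x - y))\<^sup>2"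
      by (subst power2_norm_eq_inner, subst euclidean_inner) (simp add: inner_diff_left power2_eq_square)
    finally show ?thesis .
  qed
  \<comment> \<open>The squared distance is unbounded and so no multiplier itself. The limit in
    \<open>k\<close> is therefore taken after exponentiation, where \<open>w k x \<ge> 0\<close>
    gives the uniform bound 1.\<close>
  show "multiplier (\<lambda>x. exp (- real p * ((norm (x - y))\<^sup>2 / \<rho>\<^sup>2) ^ p))" for p
  proof (rule multiplier_limit)
    have "multiplier (\<lambda>x. exp ((- real p) * ((1 / \<rho>\<^sup>2) * w k x) ^ p))" for k
      by (intro multiplier_exp multiplier_mult multiplier_power multiplier_const w)
    thus "multiplier (\<lambda>x. exp ((- real p) * (w k x / \<rho>\<^sup>2) ^ p))" for k by simp
    show "\<bar>exp (- real p * (w k x / \<rho>\<^sup>2) ^ p)\<bar> \<le> 1" for k x using w0[of k x] by simp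
    show "(\<lambda>k. exp (- real p * (w k x / \<rho>\<^sup>2) ^ p)) \<longlonglongrightarrow> exp (- real p * ((norm (x - y))\<^sup>2 / \<rho>\<^sup>2) ^ p)" for x
      using \<rho> by (intro tendsto_intros w_lim) auto
  qed
  show "\<bar>exp (- real p * ((norm (x - y))\<^sup>2 / \<rho>\<^sup>2) ^ p)\<bar> \<le> 1" for p x by simp
  show "(\<lambda>p. exp (- real p * ((norm (x - y))\<^sup>2 / \<rho>\<^sup>2) ^ p)) \<longlonglongrightarrow> indicator (ball y \<rho>) x" for x
  proof (cases "x \<in> ball y \<rho>")
    case True
    hence "(norm (x - y))\<^sup>2 < \<rho>\<^sup>2" by (intro power_strict_mono) (auto simp: dist_norm norm_minus_commute)
    hence "(\<lambda>p. real p * ((norm (x - y))\<^sup>2 / \<rho>\<^sup>2) ^ p) \<longlonglongrightarrow> 0"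
      using \<rho> by (intro powser_times_n_limit_0) (auto simp: abs_divide)
    from tendsto_exp[OF tendsto_minus[OF this]] show ?thesis using True by simp
  next
    case False
    hence "\<rho>\<^sup>2 \<le> (norm (x - y))\<^sup>2" using \<rho> by (intro power_mono) (auto simp: dist_norm norm_minus_commute)
    hence q: "1 \<le> (norm (x - y))\<^sup>2 / \<rho>\<^sup>2" using \<rho> by simp
    \<comment> \<open>On the sphere the quotient is 1 and only the factor \<open>real p\<close>
      drives the exponential to \<open>0\<close>; this makes the limit the indicator of the open
      ball.\<close>
    have "filterlim (\<lambda>p. real p * ((norm (x - y))\<^sup>2 / \<rho>\<^sup>2) ^ p) at_top sequentially"
    proof (rule filterlim_at_top_mono[OF filterlim_real_sequentially])
      show "\<forall>\<^sub>F p in sequentially. real p \<le> real p * ((norm (x - y))\<^sup>2 / \<rho>\<^sup>2) ^ p"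
        using one_le_power[OF q] by (intro always_eventually allI mult_le_cancel_left1[THEN iffD2]) auto
    qed
    hence "(\<lambda>p. exp (- (real p * ((norm (x - y))\<^sup>2 / \<rho>\<^sup>2) ^ p))) \<longlonglongrightarrow> 0"
      by (intro filterlim_compose[OF exp_at_bot] filterlim_compose[OF filterlim_uminus_at_bot_at_top])
    thus ?thesis using False by simp
  qed
qed

text \<open>The constant 1 is hermitian by \<open>real\<close>, and multiplying it by the indicator
  keeps it so. Only the ball is reflected; the exponential keeps the same \<open>z\<close> on both
  sides.\<close>

lemma integral_reflected_ball:
  assumes \<rho>: "\<rho> > 0"
  shows "(LINT \<xi>|mu. indicator (ball y \<rho>) (- \<xi>) * (cis (z \<bullet> \<xi>) * h \<xi>)) =
     cnj (LINT \<xi>|mu. indicator (ball y \<rho>) \<xi> * (cis (z \<bullet> \<xi>) * h \<xi>))"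
proof -
  have "hermitian (\<lambda>x. 1)" unfolding hermitian_def using real by (simp add: complex_eq_iff)
  hence "hermitian (\<lambda>x. indicator (ball y \<rho>) x * 1)"
    using multiplier_indicator_ball[OF \<rho>, of y] bounded_borel_const unfolding multiplier_def by blast
  thus ?thesis unfolding hermitian_def by (simp add: of_real_indicator)
qed

end

subsection \<open>The space \<open>\<H>\<^sub>0(\<rho>)\<close>\<close>

text \<open>\<open>Re\<close> is linear only over the reals, which suffices because all derivatives
  here are real ones.\<close>

lemma bounded_linear_axis_Re: "bounded_linear (\<lambda>z. axis t (complex_of_real (Re z)) :: complex^'m::finite)"
  and norm_axis_Re: "norm (axis t (complex_of_real (Re z)) :: complex^'m::finite) \<le> norm z"
proof -
  have norm: "norm (axis t (complex_of_real (Re z)) :: complex^'m::finite) \<le> norm z" for z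
    using abs_Re_le_cmod[of z]
    by (simp add: norm_vec_def L2_set_def axis_def if_distrib[where f="\<lambda>z. (cmod z)\<^sup>2"] sum.delta cong: if_cong)
  thus "norm (axis t (complex_of_real (Re z)) :: complex^'m::finite) \<le> norm z" .
  show "bounded_linear (\<lambda>z. axis t (complex_of_real (Re z)) :: complex^'m::finite)"
    by (rule bounded_linear_intro[where K=1]) (use norm in \<open>auto simp: vec_eq_iff axis_def scaleR_conv_of_real[where 'a=complex]\<close>)
qed

lemma C1_bound_axis_Re:
  "C1_bound B e f \<Longrightarrow> C1_bound B e (\<lambda>x. axis t (complex_of_real (Re (f x))) :: complex^'m::finite)"
proof -
  assume f: "C1_bound B e f"
  have "C1_bound B (1 * e) (\<lambda>x. axis t (complex_of_real (Re (f x))) :: complex^'m)"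
    by (rule C1_bound_linear[OF bounded_linear_axis_Re _ _ f]) (use norm_axis_Re in auto)
  thus ?thesis by simp
qed

text \<open>Transforms of bounded integrands form a part of \<open>H0\<close> in which every
  integral converges absolutely, so closure under sums is immediate. For \<open>L2H\<close> it would
  need a Cauchy-Schwarz argument for the matrix form.\<close>

definition Frho_bounded :: "(real^'n) measure \<Rightarrow> ('m::finite \<Rightarrow> 'm \<Rightarrow> real^'n \<Rightarrow> complex) \<Rightarrow>
    (real^'n \<Rightarrow> complex^'m) set" where
  "Frho_bounded mu h = {Frho mu h G |G. (\<forall>i. (\<lambda>\<xi>. G \<xi> $ i) \<in> borel_measurable borel) \<and>
     (\<exists>C. \<forall>\<xi> i. cmod (G \<xi> $ i) \<le> C) \<and> (\<forall>\<xi> i. G (- \<xi>) $ i = cnj (G \<xi> $ i))}"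

locale spectral_matrix =
  fixes mu :: "(real^'n) measure" and h :: "'m::finite \<Rightarrow> 'm \<Rightarrow> real^'n \<Rightarrow> complex"
  assumes dens: "\<And>i j. real_spectral_density mu (h i j)"
begin

lemma density: "integrable_density mu (h i j)"
  by (rule real_spectral_density.axioms(1)[OF dens])

lemma sets_mu[measurable_cong, simp]: "sets mu = sets borel"
  by (rule integrable_density.sets_mu[OF density])

lemma h_int: "integrable mu (h i j)"
  by (rule integrable_density.h_int[OF density])

lemma h_meas[measurable]: "h i j \<in> borel_measurable mu"
  using h_int by simp

lemma integrable_bounded_mult:
  assumes "g \<in> borel_measurable borel" "\<And>\<xi>. cmod (g \<xi>) \<le> C"
  shows "integrable mu (\<lambda>\<xi>. g \<xi> * h i j \<xi>)"
proof -
  have [measurable]: "g \<in> borel_measurable mu" using assms(1) by (simp add: measurable_cong_sets[OF sets_mu refl])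
  have C: "cmod (g \<xi>) \<le> \<bar>C\<bar>" for \<xi> using assms(2) by (meson abs_ge_self order_trans)
  show ?thesis
    by (rule Bochner_Integration.integrable_bound[OF integrable_mult_right[OF h_int[of i j], of "complex_of_real C"]])
      (use C in \<open>auto simp: norm_mult intro!: mult_right_mono\<close>)
qed

lemma Frho_bounded_subset_H0: "Frho_bounded mu h \<subseteq> H0 mu h"
proof -
  have "G \<in> L2H mu h" if G: "\<forall>i. (\<lambda>\<xi>. G \<xi> $ i) \<in> borel_measurable borel" "\<forall>\<xi> i. cmod (G \<xi> $ i) \<le> C"
    "\<forall>\<xi> i. G (- \<xi>) $ i = cnj (G \<xi> $ i)" for G :: "real^'n \<Rightarrow> complex^'m" and C
    unfolding L2H_def
  proof (intro CollectI conjI)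
    have [measurable]: "(\<lambda>\<xi>. G \<xi> $ i) \<in> borel_measurable borel" for i using G(1) by blast
    show "\<forall>i. (\<lambda>\<xi>. G \<xi> $ i) \<in> borel_measurable mu" using G(1) by (simp add: measurable_cong_sets[OF sets_mu refl])
    show "integrable mu (\<lambda>\<xi>. \<Sum>i1\<in>UNIV. \<Sum>i2\<in>UNIV. G \<xi> $ i1 * cnj (G \<xi> $ i2) * h i1 i2 \<xi>)"
    proof (intro Bochner_Integration.integrable_sum integrable_bounded_mult)
      show "(\<lambda>\<xi>. G \<xi> $ i1 * cnj (G \<xi> $ i2)) \<in> borel_measurable borel" for i1 i2
      proof -
        have "cnj \<in> borel_measurable borel" by (intro borel_measurable_continuous_onI continuous_intros)
        from measurable_compose[OF G(1)[rule_format, of i2] this] G(1)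
        show ?thesis by (intro borel_measurable_times) auto
      qed
      show "cmod (G \<xi> $ i1 * cnj (G \<xi> $ i2)) \<le> C * C" for \<xi> i1 i2
        using G(2) order_trans[OF norm_ge_zero G(2)[rule_format]] by (auto simp: norm_mult intro!: mult_mono)
    qed
  qed (use G(3) in auto)
  thus ?thesis unfolding Frho_bounded_def H0_def by blast
qed

lemma borel_measurable_exp_inner: "(\<lambda>\<xi>::real^'n. exp (- \<i> * complex_of_real (x \<bullet> \<xi>))) \<in> borel_measurable borel"
  by (intro borel_measurable_continuous_onI continuous_intros)

lemma integrable_Frho:
  assumes "\<forall>i. (\<lambda>\<xi>. G \<xi> $ i) \<in> borel_measurable borel" "\<forall>\<xi> i. cmod (G \<xi> $ i) \<le> C"
  shows "integrable mu (\<lambda>\<xi>. exp (- \<i> * complex_of_real (x \<bullet> \<xi>)) * (G \<xi> $ i * h i j \<xi>))"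
proof -
  have "integrable mu (\<lambda>\<xi>. (exp (- \<i> * complex_of_real (x \<bullet> \<xi>)) * G \<xi> $ i) * h i j \<xi>)"
    by (rule integrable_bounded_mult[where C=C])
      (use assms in \<open>auto simp: norm_mult intro!: borel_measurable_times borel_measurable_exp_inner\<close>)
  thus ?thesis by (simp add: mult.assoc)
qed

lemma Frho_bounded_zero: "(\<lambda>x. 0) \<in> Frho_bounded mu h"
  unfolding Frho_bounded_def
  by (intro CollectI exI[of _ "\<lambda>\<xi>. 0"]) (auto simp: Frho_def vec_eq_iff fun_eq_iff intro: exI[of _ 0])

lemma Frho_bounded_add:
  assumes "H1 \<in> Frho_bounded mu h" "H2 \<in> Frho_bounded mu h"
  shows "(\<lambda>x. H1 x + H2 x) \<in> Frho_bounded mu h"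
proof -
  from assms(1) obtain G1 C1 where G1: "H1 = Frho mu h G1" "\<forall>i. (\<lambda>\<xi>. G1 \<xi> $ i) \<in> borel_measurable borel"
    "\<forall>\<xi> i. cmod (G1 \<xi> $ i) \<le> C1" "\<forall>\<xi> i. G1 (- \<xi>) $ i = cnj (G1 \<xi> $ i)" unfolding Frho_bounded_def by blast
  from assms(2) obtain G2 C2 where G2: "H2 = Frho mu h G2" "\<forall>i. (\<lambda>\<xi>. G2 \<xi> $ i) \<in> borel_measurable borel"
    "\<forall>\<xi> i. cmod (G2 \<xi> $ i) \<le> C2" "\<forall>\<xi> i. G2 (- \<xi>) $ i = cnj (G2 \<xi> $ i)" unfolding Frho_bounded_def by blast
  have "(\<lambda>x. H1 x + H2 x) = Frho mu h (\<lambda>\<xi>. G1 \<xi> + G2 \<xi>)"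
    unfolding G1(1) G2(1)
    using integrable_Frho[OF G1(2,3)] integrable_Frho[OF G2(2,3)]
    by (auto simp: Frho_def vec_eq_iff fun_eq_iff distrib_right sum.distrib distrib_left sum_distrib_left
        Bochner_Integration.integral_add)
  moreover have "cmod ((G1 \<xi> + G2 \<xi>) $ i) \<le> C1 + C2" for \<xi> i
    using G1(3) G2(3) by (auto intro: norm_triangle_mono)
  ultimately show ?thesis unfolding Frho_bounded_def using G1 G2
    by (intro CollectI exI[of _ "\<lambda>\<xi>. G1 \<xi> + G2 \<xi>"]) (auto intro!: borel_measurable_add)
qed

text \<open>Half of \<open>b i\<close> on \<open>U\<close> and half of its conjugate on
  \<open>- U\<close> form a symmetric integrand. By \<open>integral_reflected_ball\<close> the
  second half contributes the complex conjugate of the first, and the sum is a real part.\<close>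

lemma Frho_symmetrized_ball:
  fixes b :: "'m \<Rightarrow> complex"
  assumes \<eta>: "\<eta> > 0"
  shows "(\<lambda>x. \<Sum>s\<in>UNIV. axis s (complex_of_real (Re (\<Sum>i\<in>UNIV. b i *
      (LINT \<zeta>|mu. indicator (ball \<xi> \<eta>) \<zeta> * (cis (- (x \<bullet> \<zeta>)) * h i s \<zeta>)))))) \<in> Frho_bounded mu h"
proof -
  define U where "U = ball \<xi> \<eta>"
  have [measurable]: "U \<in> sets borel" by (simp add: U_def)
  define G :: "real^'n \<Rightarrow> complex^'m" where
    "G \<zeta> = (\<chi> i. b i / 2 * indicator U \<zeta> + cnj (b i) / 2 * indicator U (- \<zeta>))" for \<zeta>
  define J where "J i s x = (LINT \<zeta>|mu. indicator U \<zeta> * (cis (- (x \<bullet> \<zeta>)) * h i s \<zeta>))" for i s x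
  have J_reflect: "(LINT \<zeta>|mu. indicator U (- \<zeta>) * (cis (- (x \<bullet> \<zeta>)) * h i s \<zeta>)) = cnj (J i s x)" for i s x
    using real_spectral_density.integral_reflected_ball[OF dens[of i s] \<eta>, of \<xi> "- x"]
    by (simp add: J_def U_def)
  have [measurable]: "(uminus :: real^'n \<Rightarrow> real^'n) \<in> borel_measurable borel"
    by (intro borel_measurable_continuous_onI continuous_intros)
  have cis: "(\<lambda>\<zeta>::real^'n. cis (- (x \<bullet> \<zeta>))) \<in> borel_measurable borel" for x
    by (intro borel_measurable_continuous_onI continuous_intros)
  note [measurable] = cis
  have int1: "integrable mu (\<lambda>\<zeta>. indicator U \<zeta> * (cis (- (x \<bullet> \<zeta>)) * h i s \<zeta>))" for x i s
    using integrable_bounded_mult[of "\<lambda>\<zeta>. indicator U \<zeta> * cis (- (x \<bullet> \<zeta>))" 1]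
    by (simp add: mult.assoc norm_mult indicator_def)
  have int2: "integrable mu (\<lambda>\<zeta>. indicator U (- \<zeta>) * (cis (- (x \<bullet> \<zeta>)) * h i s \<zeta>))" for x i s
    using integrable_bounded_mult[of "\<lambda>\<zeta>. indicator U (- \<zeta>) * cis (- (x \<bullet> \<zeta>))" 1]
    by (simp add: mult.assoc norm_mult indicator_def)
  have "Frho mu h G = (\<lambda>x. \<Sum>s\<in>UNIV. axis s (complex_of_real (Re (\<Sum>i\<in>UNIV. b i * J i s x))))"
  proof
    fix x
    have "Frho mu h G x $ s = complex_of_real (Re (\<Sum>i\<in>UNIV. b i * J i s x))" for s
    proof -
      have "Frho mu h G x $ s = (LINT \<zeta>|mu. (\<Sum>i\<in>UNIV.
         b i / 2 * (indicator U \<zeta> * (cis (- (x \<bullet> \<zeta>)) * h i s \<zeta>)) +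
         cnj (b i) / 2 * (indicator U (- \<zeta>) * (cis (- (x \<bullet> \<zeta>)) * h i s \<zeta>))))"
        unfolding Frho_def G_def by (simp add: cis_conv_exp sum_distrib_left distrib_left distrib_right mult_ac)
      also have "\<dots> = (\<Sum>i\<in>UNIV. b i / 2 * J i s x + cnj (b i) / 2 * cnj (J i s x))"
        by (subst Bochner_Integration.integral_sum; (intro Bochner_Integration.integrable_add integrable_mult_right int1 int2)?)
          (simp add: int1 int2 J_reflect J_def[symmetric])
      also have "\<dots> = (\<Sum>i\<in>UNIV. complex_of_real (Re (b i * J i s x)))"
      proof (rule sum.cong[OF refl])
        fix i
        have "b i / 2 * J i s x + cnj (b i) / 2 * cnj (J i s x) = (b i * J i s x + cnj (b i * J i s x)) / 2"
          by (simp add: add_divide_distrib)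
        also have "\<dots> = complex_of_real (Re (b i * J i s x))" by (simp only: complex_add_cnj) simp
        finally show "b i / 2 * J i s x + cnj (b i) / 2 * cnj (J i s x) = complex_of_real (Re (b i * J i s x))" .
      qed
      finally show ?thesis by simp
    qed
    thus "Frho mu h G x = (\<Sum>s\<in>UNIV. axis s (complex_of_real (Re (\<Sum>i\<in>UNIV. b i * J i s x))))"
      by (simp add: vec_eq_iff axis_def if_distrib[where f="\<lambda>f. f _"] sum.delta cong: if_cong)
  qed
  moreover have "Frho mu h G \<in> Frho_bounded mu h"
    unfolding Frho_bounded_def
  proof (intro CollectI exI[of _ G] conjI allI)
    show "(\<lambda>\<xi>. G \<xi> $ i) \<in> borel_measurable borel" for i unfolding G_def by simp
    show "G (- \<xi>) $ i = cnj (G \<xi> $ i)" for \<xi> i unfolding G_def by (simp add: indicator_def)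
    have "cmod (G \<xi> $ i) \<le> (\<Sum>i\<in>UNIV. cmod (b i))" for \<xi> i
    proof -
      have "cmod (G \<xi> $ i) \<le> cmod (b i / 2 * indicator U \<xi>) + cmod (cnj (b i) / 2 * indicator U (- \<xi>))"
        unfolding G_def by (simp only: vec_lambda_beta norm_triangle_ineq)
      also have "\<dots> \<le> cmod (b i)" by (simp add: norm_mult norm_divide indicator_def)
      also have "\<dots> \<le> (\<Sum>i\<in>UNIV. cmod (b i))" by (intro member_le_sum) auto
      finally show ?thesis .
    qed
    thus "\<exists>C. \<forall>\<xi> i. cmod (G \<xi> $ i) \<le> C" by blast
  qed auto
  ultimately show ?thesis by (simp add: J_def U_def)
qed

text \<open>For small \<open>U\<close> around \<open>\<xi>\<close> the coefficients
  \<open>a * c U i\<close> reproduce the exponential exactly once the kernel is frozen at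
  \<open>\<xi>\<close>: component \<open>t\<close> receives it and the others receive
  \<open>0\<close>. The freezing error is linear in the radius, with a factor that does not depend
  on \<open>U\<close>.\<close>

lemma cosine_in_C1_closure:
  fixes C1 C2 :: real
  assumes B: "bounded B" and \<xi>: "\<xi> \<in> ball y r" and C: "C1 > 0" "C2 > 0"
    and c: "\<And>U s. open U \<Longrightarrow> U \<noteq> {} \<Longrightarrow> U \<subseteq> ball y r \<Longrightarrow>
        (\<Sum>i\<in>UNIV. c U i * rho mu h i s U) = (if t = s then 1 else 0)"
    and c1: "\<And>i s U. open U \<Longrightarrow> U \<subseteq> ball y r \<Longrightarrow> rho_var mu h i s U \<le> C1 * cmod (rho mu h i s U)"
    and c2: "\<And>s U. open U \<Longrightarrow> U \<subseteq> ball y r \<Longrightarrow> (\<Sum>i\<in>UNIV. cmod (c U i * rho mu h i s U)) \<le> C2"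
  shows "(\<lambda>x. axis t (complex_of_real (Re (a * cis (- (x \<bullet> \<xi>)))))) \<in> C1_closure B (Frho_bounded mu h)"
proof (rule C1_closureI)
  fix e :: real assume e: "e > 0"
  obtain R where R: "R > 0" "\<And>x. x \<in> B \<Longrightarrow> norm x \<le> R" using B by (auto simp: bounded_pos)
  \<comment> \<open>\<open>E * \<eta>\<close> will bound the error. \<open>CARD('m)\<close> arises
    because the errors of all components are summed, and \<open>cmod a + 1\<close> keeps
    \<open>E\<close> positive when \<open>a = 0\<close>.\<close>
  define E where "E = real CARD('m) * (cmod a + 1) * (C1 * C2) * (1 + R + R * norm \<xi>)"
  have "1 + R + R * norm \<xi> > 0" "cmod a + 1 > 0" using R(1) by (auto intro: add_pos_nonneg add_nonneg_pos)
  hence E: "E > 0" unfolding E_def using C by simp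
  obtain \<eta>0 where \<eta>0: "\<eta>0 > 0" "ball \<xi> \<eta>0 \<subseteq> ball y r" using \<xi> open_contains_ball open_ball by meson
  define \<eta> where "\<eta> = min \<eta>0 (e / E)"
  have \<eta>: "\<eta> > 0" using \<eta>0 e E by (simp add: \<eta>_def)
  define U where "U = ball \<xi> \<eta>"
  have U: "open U" "U \<noteq> {}" "U \<subseteq> ball y r" using \<eta>0 \<eta> by (auto simp: U_def \<eta>_def)
  have \<rho>: "rho mu h i s U = (LINT \<zeta>|mu. indicator (ball \<xi> \<eta>) \<zeta> * h i s \<zeta>)" for i s
    unfolding rho_def set_lebesgue_integral_def U_def by (simp add: scaleR_conv_of_real of_real_indicator)
  have \<rho>v: "rho_var mu h i s U = (LINT \<zeta>|mu. indicator (ball \<xi> \<eta>) \<zeta> * cmod (h i s \<zeta>))" for i s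
    unfolding rho_var_def set_lebesgue_integral_def U_def by simp
  define J where "J i s x = (LINT \<zeta>|mu. indicator (ball \<xi> \<eta>) \<zeta> * (cis (- (x \<bullet> \<zeta>)) * h i s \<zeta>))" for i s x
  define \<kappa> where "\<kappa> = \<eta> * (1 + R + R * norm \<xi>)"
  have \<kappa>: "\<kappa> \<ge> 0" using \<eta> R(1) by (simp add: \<kappa>_def)
  have J: "C1_bound B (\<kappa> * rho_var mu h i s U) (\<lambda>x. J i s x - cis (- (x \<bullet> \<xi>)) * rho mu h i s U)" for i s
    unfolding \<rho> \<rho>v J_def \<kappa>_def
    by (rule integrable_density.C1_bound_local_fourier[OF density]) (use R \<eta> in auto)
  define S where "S s x = (\<Sum>i\<in>UNIV. (a * c U i) * J i s x)" for s x
  have S: "C1_bound B (cmod a * \<kappa> * (C1 * C2)) (\<lambda>x. S s x - (if t = s then a * cis (- (x \<bullet> \<xi>)) else 0))" for s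
  proof (rule C1_bound_mono)
    have "C1_bound B (\<Sum>i\<in>UNIV. cmod (a * c U i) * (\<kappa> * rho_var mu h i s U))
      (\<lambda>x. \<Sum>i\<in>UNIV. (a * c U i) * (J i s x - cis (- (x \<bullet> \<xi>)) * rho mu h i s U))"
      by (intro C1_bound_sum C1_bound_linear J bounded_linear_mult_right) (auto simp: norm_mult)
    also have "(\<lambda>x. \<Sum>i\<in>UNIV. (a * c U i) * (J i s x - cis (- (x \<bullet> \<xi>)) * rho mu h i s U)) =
       (\<lambda>x. S s x - (if t = s then a * cis (- (x \<bullet> \<xi>)) else 0))"
    proof
      fix x
      have "(\<Sum>i\<in>UNIV. (a * c U i) * (J i s x - cis (- (x \<bullet> \<xi>)) * rho mu h i s U)) =
         S s x - a * cis (- (x \<bullet> \<xi>)) * (\<Sum>i\<in>UNIV. c U i * rho mu h i s U)"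
        unfolding S_def by (simp add: right_diff_distrib sum_subtractf sum_distrib_left mult_ac)
      thus "(\<Sum>i\<in>UNIV. (a * c U i) * (J i s x - cis (- (x \<bullet> \<xi>)) * rho mu h i s U)) =
         S s x - (if t = s then a * cis (- (x \<bullet> \<xi>)) else 0)" by (simp add: c[OF U])
    qed
    finally show "C1_bound B (\<Sum>i\<in>UNIV. cmod (a * c U i) * (\<kappa> * rho_var mu h i s U))
       (\<lambda>x. S s x - (if t = s then a * cis (- (x \<bullet> \<xi>)) else 0))" .
    \<comment> \<open>The variation is traded for \<open>C1\<close> times the modulus of
      \<open>rho\<close>, which then joins the coefficient: only the product
      \<open>c U i * rho mu h i s U\<close> is controlled.\<close>
    have "(\<Sum>i\<in>UNIV. cmod (a * c U i) * (\<kappa> * rho_var mu h i s U)) \<le>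
       (\<Sum>i\<in>UNIV. cmod (a * c U i) * (\<kappa> * (C1 * cmod (rho mu h i s U))))"
      using c1[OF U(1,3)] \<kappa> by (intro sum_mono mult_left_mono) auto
    also have "\<dots> = cmod a * \<kappa> * (C1 * (\<Sum>i\<in>UNIV. cmod (c U i * rho mu h i s U)))"
      by (simp add: sum_distrib_left norm_mult mult_ac)
    also have "\<dots> \<le> cmod a * \<kappa> * (C1 * C2)"
      using c2[OF U(1,3)] \<kappa> C by (intro mult_left_mono) auto
    finally show "(\<Sum>i\<in>UNIV. cmod (a * c U i) * (\<kappa> * rho_var mu h i s U)) \<le> cmod a * \<kappa> * (C1 * C2)" .
  qed
  have "C1_bound B (\<Sum>s\<in>(UNIV::'m set). cmod a * \<kappa> * (C1 * C2))
     (\<lambda>x. \<Sum>s\<in>UNIV. axis s (complex_of_real (Re (S s x - (if t = s then a * cis (- (x \<bullet> \<xi>)) else 0)))) :: complex^'m)"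
    by (intro C1_bound_sum C1_bound_axis_Re S) auto
  moreover have "(\<Sum>s\<in>UNIV. axis s (complex_of_real (Re (S s x - (if t = s then a * cis (- (x \<bullet> \<xi>)) else 0)))) :: complex^'m) =
     (\<Sum>s\<in>UNIV. axis s (complex_of_real (Re (S s x)))) - axis t (complex_of_real (Re (a * cis (- (x \<bullet> \<xi>)))))" for x
    by (auto simp: vec_eq_iff axis_def if_distrib[where f="\<lambda>f. f _"] sum.delta cong: if_cong)
  moreover have "(\<Sum>s\<in>(UNIV::'m set). cmod a * \<kappa> * (C1 * C2)) \<le> e"
  proof -
    have "(\<Sum>s\<in>(UNIV::'m set). cmod a * \<kappa> * (C1 * C2)) = real CARD('m) * cmod a * (C1 * C2) * (1 + R + R * norm \<xi>) * \<eta>"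
      by (simp add: \<kappa>_def mult_ac)
    also have "\<dots> \<le> E * \<eta>" unfolding E_def
      using \<eta> R(1) C by (intro mult_right_mono mult_left_mono) auto
    also have "\<dots> \<le> E * (e / E)" using E by (intro mult_left_mono) (auto simp: \<eta>_def)
    also have "\<dots> = e" using E by simp
    finally show ?thesis .
  qed
  ultimately have "C1_bound B e (\<lambda>x. (\<Sum>s\<in>UNIV. axis s (complex_of_real (Re (S s x)))) - axis t (complex_of_real (Re (a * cis (- (x \<bullet> \<xi>))))) :: complex^'m)"
    using C1_bound_mono by fastforce
  moreover have "(\<lambda>x. \<Sum>s\<in>UNIV. axis s (complex_of_real (Re (S s x)))) \<in> Frho_bounded mu h"
    unfolding S_def J_def by (rule Frho_symmetrized_ball[OF \<eta>])
  ultimately show "\<exists>g\<in>Frho_bounded mu h. C1_bound B e (\<lambda>x. g x - axis t (complex_of_real (Re (a * cis (- (x \<bullet> \<xi>))))))"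
    by (intro bexI[of _ "\<lambda>x. \<Sum>s\<in>UNIV. axis s (complex_of_real (Re (S s x)))"])
qed

lemma trig_in_C1_closure:
  assumes "\<And>\<xi> a. \<xi> \<in> \<Omega> \<Longrightarrow>
     (\<lambda>x. axis t (complex_of_real (Re (a * cis (- (x \<bullet> \<xi>)))))) \<in> C1_closure B (Frho_bounded mu h)"
    and "f \<in> trig \<Omega>"
  shows "(\<lambda>x. axis t (complex_of_real (Re (f x)))) \<in> C1_closure B (Frho_bounded mu h)"
  using assms(2)
proof induction
  case zero
  have "axis t 0 = (0 :: complex^'m)" by (simp add: vec_eq_iff axis_def)
  thus ?case using subset_C1_closure[OF Frho_bounded_zero] by (simp only: zero_complex.sel of_real_0)
next
  case (add_cis f \<xi> a)
  have "(\<lambda>x. axis t (complex_of_real (Re (f x))) + axis t (complex_of_real (Re (a * cis (- (x \<bullet> \<xi>))))))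
    \<in> C1_closure B (Frho_bounded mu h)"
    by (rule C1_closure_add[OF add_cis(3) assms(1)[OF add_cis(2)] Frho_bounded_add])
  moreover have "axis t (complex_of_real (Re (f x))) + axis t (complex_of_real (Re (a * cis (- (x \<bullet> \<xi>))))) =
     (axis t (complex_of_real (Re (f x + a * cis (- (x \<bullet> \<xi>))))) :: complex^'m)" for x
    by (auto simp: vec_eq_iff axis_def)
  ultimately show ?case by simp
qed

end

section \<open>From the covariance representation to density\<close>

text \<open>At \<open>y = 0\<close> the covariance identity shows the Fourier transform of each
  entry as an expectation of a product of real variables.\<close>

lemma is_spectral_measure_imp_spectral_matrix:
  assumes "is_spectral_measure M F mu h"
  shows "spectral_matrix mu h"
proof
  fix i j
  from assms have psd: "psd_matrix_measure mu h" and
    cov: "\<And>x y. complex_of_real (integral\<^sup>L M (\<lambda>\<omega>. F x \<omega> $ i * F y \<omega> $ j)) =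
        (LINT \<xi>|mu. exp (\<i> * complex_of_real ((x - y) \<bullet> \<xi>)) * h i j \<xi>)"
    unfolding is_spectral_measure_def by blast+
  show "sets mu = sets borel" "integrable mu (h i j)" using psd unfolding psd_matrix_measure_def by auto
  fix z
  have "(LINT \<xi>|mu. cis (z \<bullet> \<xi>) * h i j \<xi>) = complex_of_real (integral\<^sup>L M (\<lambda>\<omega>. F z \<omega> $ i * F 0 \<omega> $ j))"
    using cov[of z 0] by (simp add: cis_conv_exp)
  thus "Im (LINT \<xi>|mu. cis (z \<bullet> \<xi>) * h i j \<xi>) = 0" by simp
qed

lemma bounded_linear_cvec: "bounded_linear (cvec :: real^'m \<Rightarrow> complex^'m::finite)"
proof (rule bounded_linear_intro[where K=1])
  show "norm (cvec v :: complex^'m) \<le> norm v * 1" for v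
    by (simp add: norm_vec_def cvec_def L2_set_def)
qed (auto simp: cvec_def vec_eq_iff scaleR_conv_of_real[where 'a=complex])

text \<open>A continuously differentiable function up to the boundary of \<open>B\<close> is
  rendered by one on an open \<open>S\<close> containing the closure. The uniform bound
  \<open>e < \<epsilon>\<close> says that the supremum over \<open>B\<close> lies strictly below
  \<open>\<epsilon>\<close>.\<close>

theorem theoremC1:
  fixes M :: "'a measure"
    and F :: "real^'n \<Rightarrow> 'a \<Rightarrow> real^'m"
    and mu :: "(real^'n) measure"
    and h :: "'m \<Rightarrow> 'm \<Rightarrow> real^'n \<Rightarrow> complex"
  assumes gauss: "centered_gaussian_field M F"
    and smooth: "AE \<omega> in M. C3minus (\<lambda>x. F x \<omega>)"
    and spec: "is_spectral_measure M F mu h"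
    and nondeg: "m_balls_abs_nondegenerate mu h"
  shows "\<forall>(B :: (real^'n) set) (G :: real^'n \<Rightarrow> real^'m) (G' :: real^'n \<Rightarrow> ((real^'n) \<Rightarrow>\<^sub>L (real^'m)))
            (S :: (real^'n) set) (\<epsilon>::real).
           bounded B \<and> open B \<and> open S \<and> closure B \<subseteq> S \<and>
           (\<forall>x\<in>S. (G has_derivative blinfun_apply (G' x)) (at x)) \<and> continuous_on S G' \<and>
           \<epsilon> > 0 \<longrightarrow>
           (\<exists>H\<in>H0 mu h. \<exists>H'. (\<forall>x\<in>B. (H has_derivative H' x) (at x)) \<and>
              (\<exists>e<\<epsilon>. \<forall>x\<in>B. norm (H x - cvec (G x)) +
                        onorm (\<lambda>v. H' x v - cvec (blinfun_apply (G' x) v)) \<le> e))"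
proof (intro allI impI, elim conjE)
  fix B :: "(real^'n) set" and G :: "real^'n \<Rightarrow> real^'m" and G' :: "real^'n \<Rightarrow> ((real^'n) \<Rightarrow>\<^sub>L (real^'m))"
    and S :: "(real^'n) set" and \<epsilon> :: real
  assume B: "bounded B" and S: "open S" "closure B \<subseteq> S"
    and G: "\<forall>x\<in>S. (G has_derivative blinfun_apply (G' x)) (at x)" and G': "continuous_on S G'" and \<epsilon>: "\<epsilon> > 0"
  interpret spectral_matrix mu h by (rule is_spectral_measure_imp_spectral_matrix[OF spec])
  obtain y r c C1 C2 where r: "\<forall>t. r t > 0" and C: "C1 > 0" "C2 > 0"
    and c: "\<forall>t U. open U \<and> U \<noteq> {} \<and> U \<subseteq> ball (y t) (r t) \<longrightarrow>
           (\<forall>s. (\<Sum>i\<in>UNIV. c t U i * rho mu h i s U) = (if t = s then 1 else 0))"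
    and c1: "\<forall>s t V. open V \<and> V \<subseteq> (\<Union>i. ball (y i) (r i)) \<longrightarrow>
           rho_var mu h s t V \<le> C1 * cmod (rho mu h s t V)"
    and c2: "\<forall>s t U. open U \<and> U \<subseteq> ball (y t) (r t) \<longrightarrow>
           (\<Sum>i\<in>UNIV. cmod (c t U i * rho mu h i s U)) \<le> C2"
    using nondeg unfolding m_balls_abs_nondegenerate_def by (elim exE conjE) (rule that, assumption+)
  have comp: "(\<lambda>x. axis t (complex_of_real (G x $ t)) :: complex^'m) \<in> C1_closure B (Frho_bounded mu h)" for t
  proof -
    define g where "g x = G x $ t" for x
    define g' where "g' x = blinfun_inner_left (axis t 1) o\<^sub>L G' x" for x
    have "(\<lambda>x. complex_of_real (g x)) \<in> C1_closure B (trig (ball (y t) (r t)))"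
    proof (rule C1_in_closure_trig[OF B S, of g g'])
      show "(g has_derivative blinfun_apply (g' x)) (at x)" if "x \<in> S" for x
      proof -
        have "((\<lambda>x. G x \<bullet> axis t 1) has_derivative (\<lambda>v. G' x v \<bullet> axis t 1)) (at x)"
          using G that by (auto intro!: derivative_eq_intros)
        moreover have "blinfun_apply (g' x) = (\<lambda>v. G' x v \<bullet> axis t 1)" by (auto simp: g'_def)
        ultimately show ?thesis by (simp add: g_def[abs_def] inner_axis)
      qed
      show "continuous_on S g'" unfolding g'_def by (intro continuous_intros G')
    qed (use r in blast)
    \<comment> \<open>The approximating sums are complex, while only their real parts are limits of
      elements of \<open>H0\<close>. Since \<open>g\<close> is real, taking real parts leaves the
      target unchanged.\<close>
    hence "(\<lambda>x. axis t (complex_of_real (Re (complex_of_real (g x)))) :: complex^'m) \<in>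
       C1_closure B {\<lambda>x. axis t (complex_of_real (Re (f x))) |f. f \<in> trig (ball (y t) (r t))}"
      by (rule C1_closure_linear[OF bounded_linear_axis_Re]) auto
    moreover have "{\<lambda>x. axis t (complex_of_real (Re (f x))) |f. f \<in> trig (ball (y t) (r t))} \<subseteq> C1_closure B (Frho_bounded mu h)"
    proof -
      have sub: "ball (y t) (r t) \<subseteq> (\<Union>i. ball (y i) (r i))" by blast
      have "(\<lambda>x. axis t (complex_of_real (Re (a * cis (- (x \<bullet> \<xi>)))))) \<in> C1_closure B (Frho_bounded mu h)"
        if "\<xi> \<in> ball (y t) (r t)" for \<xi> a
      proof (rule cosine_in_C1_closure[OF B that C, where c="c t"])
        show "(\<Sum>i\<in>UNIV. c t U i * rho mu h i s U) = (if t = s then 1 else 0)"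
          if "open U" "U \<noteq> {}" "U \<subseteq> ball (y t) (r t)" for U s
          using c that by blast
        show "rho_var mu h i s U \<le> C1 * cmod (rho mu h i s U)"
          if "open U" "U \<subseteq> ball (y t) (r t)" for i s U
          using c1 that sub by (meson order_trans)
        show "(\<Sum>i\<in>UNIV. cmod (c t U i * rho mu h i s U)) \<le> C2"
          if "open U" "U \<subseteq> ball (y t) (r t)" for s U
          using c2 that by blast
      qed
      thus ?thesis using trig_in_C1_closure by blast
    qed
    ultimately have "(\<lambda>x. axis t (complex_of_real (Re (complex_of_real (g x)))) :: complex^'m) \<in>
       C1_closure B (Frho_bounded mu h)" by (rule C1_closure_idem)
    thus ?thesis by (simp add: g_def)
  qed
  have "(\<lambda>x. \<Sum>t\<in>UNIV. axis t (complex_of_real (G x $ t)) :: complex^'m) \<in> C1_closure B (Frho_bounded mu h)"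
    by (intro C1_closure_sum comp Frho_bounded_zero Frho_bounded_add) auto
  also have "(\<lambda>x. \<Sum>t\<in>UNIV. axis t (complex_of_real (G x $ t)) :: complex^'m) = (\<lambda>x. cvec (G x))"
    by (auto simp: cvec_def vec_eq_iff axis_def fun_eq_iff if_distrib[where f="\<lambda>f. f _"] sum.delta cong: if_cong)
  \<comment> \<open>A third for the value and a third for the derivative leave room for the strict
    inequality.\<close>
  finally obtain H where H: "H \<in> Frho_bounded mu h" "C1_bound B (\<epsilon> / 3) (\<lambda>x. H x - cvec (G x))"
    by (rule C1_closureE[of _ _ _ "\<epsilon> / 3"]) (use \<epsilon> in auto)
  have "\<forall>x\<in>B. \<exists>D. norm (H x - cvec (G x)) \<le> \<epsilon> / 3 \<and> ((\<lambda>x. H x - cvec (G x)) has_derivative D) (at x) \<and>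
     (\<forall>v. norm (D v) \<le> \<epsilon> / 3 * norm v)"
    using H(2) unfolding C1_bound_def by blast
  from bchoice[OF this] obtain D where "\<forall>x\<in>B. norm (H x - cvec (G x)) \<le> \<epsilon> / 3 \<and>
     ((\<lambda>x. H x - cvec (G x)) has_derivative D x) (at x) \<and> (\<forall>v. norm (D x v) \<le> \<epsilon> / 3 * norm v)" by (rule exE)
  hence D: "\<And>x. x \<in> B \<Longrightarrow> norm (H x - cvec (G x)) \<le> \<epsilon> / 3"
    "\<And>x. x \<in> B \<Longrightarrow> ((\<lambda>x. H x - cvec (G x)) has_derivative D x) (at x)"
    "\<And>x v. x \<in> B \<Longrightarrow> norm (D x v) \<le> \<epsilon> / 3 * norm v" by blast+
  \<comment> \<open>The derivative of \<open>H\<close> is recovered from that of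
    \<open>H - cvec G\<close>, the only one that \<open>C1_bound\<close> provides.\<close>
  define H' where "H' x v = D x v + cvec (blinfun_apply (G' x) v)" for x v
  show "\<exists>H\<in>H0 mu h. \<exists>H'. (\<forall>x\<in>B. (H has_derivative H' x) (at x)) \<and>
     (\<exists>e<\<epsilon>. \<forall>x\<in>B. norm (H x - cvec (G x)) + onorm (\<lambda>v. H' x v - cvec (blinfun_apply (G' x) v)) \<le> e)"
  proof (intro bexI[of _ H] exI[of _ H'] conjI ballI exI[of _ "2 * \<epsilon> / 3"])
    show "H \<in> H0 mu h" using H(1) Frho_bounded_subset_H0 by blast
    show "2 * \<epsilon> / 3 < \<epsilon>" using \<epsilon> by simp
    fix x assume x: "x \<in> B"
    hence "x \<in> S" using S(2) closure_subset by blast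
    hence "(G has_derivative blinfun_apply (G' x)) (at x)" using G by blast
    from has_derivative_add[OF D(2)[OF x] bounded_linear.has_derivative[OF bounded_linear_cvec this]]
    show "(H has_derivative H' x) (at x)" unfolding H'_def by simp
    have "onorm (\<lambda>v. H' x v - cvec (blinfun_apply (G' x) v)) \<le> \<epsilon> / 3"
      by (rule onorm_bound) (use \<epsilon> D(3)[OF x] in \<open>auto simp: H'_def\<close>)
    thus "norm (H x - cvec (G x)) + onorm (\<lambda>v. H' x v - cvec (blinfun_apply (G' x) v)) \<le> 2 * \<epsilon> / 3"
      using D(1)[OF x] by simp
  qed
qed

end
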